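(* Let $G$ be an amenable group with a finite symmetric set of generators $S$, the corresponding left-invariant word metric $d$, and identity element $e$, and let $\{W_t\}_{t=0}^\infty$ be the canonical simple random walk on the Cayley graph of $G$ determined by $S$, starting at $e$. Assume that there exist $c,\delta,\beta>0$ such that for all $t\in\mathbb{N}$, $$\Pr\left(d(W_t,e)\ge ct^\beta\right)\ge\delta.$$ Let $p\in[1,\infty)$, let $(X,d_X)$ be a metric space with Markov type $p$, with Markov type $p$ constant $M_p(X)$, and assume that $f:G\to X$ satisfies $$\rho(d(x,y))\le d_X(f(x),f(y))\le d(x,y)$$ for all $x,y\in G$, where $\rho:\mathbb{R}_+\to\mathbb{R}_+$ is non-decreasing. Then for all $t\in\mathbb{N}$, $$\rho\left(ct^\beta\right)\le\frac{M_p(X)}{\delta^{1/p}}\,t^{1/p}.$$ In particular (whenever $G$ is amenable with finite symmetric set of generators $S$ and $c,\delta,\beta>0$ are such that $\Pr\left(d(W_t,e)\ge ct^\beta\right)\ge\delta$ for all $t\in\mathbb{N}$), the Hilbert compression exponent of $G$ satisfies $$\alpha^*(G)\le\frac{1}{2\beta}.$$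
   Context: $\mathbb{N}$ denotes the positive integers and $\mathbb{R}_+=[0,\infty)$. Symmetric means $S^{-1}=S$. The left-invariant word metric is: $d(x,y)$ is the least $n\ge 0$ such that $x^{-1}y$ is a product of $n$ elements of $S$. The simple random walk is: $W_0=e$ and $W_{t+1}=W_t s_{t+1}$, where $s_1,s_2,\dots$ are independent and uniformly distributed on $S$. Markov type: a Markov chain $\{Z_t\}_{t=0}^\infty$ with transition probabilities $a_{ij}=\Pr(Z_{t+1}=j\mid Z_t=i)$ on the state space $\{1,\dots,n\}$ is stationary if $\pi_i=\Pr(Z_t=i)$ does not depend on $t$, and it is reversible if $\pi_i a_{ij}=\pi_j a_{ji}$ for all $i,j\in\{1,\dots,n\}$. Given $p\in[1,\infty)$, a metric space $(X,d_X)$ has Markov type $p$ if there exists a constant $K>0$ such that for every $n$, every stationary reversible Markov chain $\{Z_t\}_{t=0}^\infty$ on $\{1,\dots,n\}$, every mapping $f:\{1,\dots,n\}\to X$ and every time $t\in\mathbb{N}$, $$\mathbb{E}\big[d_X(f(Z_t),f(Z_0))^p\big]\le K^p\,t\,\mathbb{E}\big[d_X(f(Z_1),f(Z_0))^p\big].$$ The least such $K$ is called the Markov type $p$ constant of $X$ and is denoted $M_p(X)$. Hilbert compression exponent: $\alpha^*(G)$ is the supremum over all $\alpha\ge 0$ such that there exist a $1$-Lipschitz mapping $f:G\to L_2$ (with respect to $d$ and the Hilbert space norm $\|\cdot\|_2$) and a constant $c>0$ such that $\|f(x)-f(y)\|_2\ge c\,d(x,y)^\alpha$ for all $x,y\in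 G$. It does not depend on the choice of the finite symmetric generating set. *)

theory Defs
  imports "HOL-Probability.Probability" "HOL-Algebra.Generated_Groups"
begin

section \<open>Amenability\<close>

text \<open>Amenability of a discrete group, in the sense of von Neumann: there is a finitely additive
  left-invariant probability measure defined on all subsets of the group.\<close>

definition amenable :: "('a, 'm) monoid_scheme \<Rightarrow> bool" where
  "amenable G \<longleftrightarrow> (\<exists>\<mu> :: 'a set \<Rightarrow> real.
     (\<forall>A \<subseteq> carrier G. 0 \<le> \<mu> A) \<and>
     \<mu> (carrier G) = 1 \<and>
     (\<forall>A \<subseteq> carrier G. \<forall>B \<subseteq> carrier G. A \<inter> B = {} \<longrightarrow> \<mu> (A \<union> B) = \<mu> A + \<mu> B) \<and>
     (\<forall>g \<in> carrier G. \<forall>A \<subseteq> carrier G. \<mu> (g <#\<^bsub>G\<^esub> A) = \<mu> A))"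


section \<open>Word metric and simple random walk\<close>

definition word_dist :: "('a, 'm) monoid_scheme \<Rightarrow> 'a set \<Rightarrow> 'a \<Rightarrow> 'a \<Rightarrow> nat" where
  "word_dist G S x y =
     (LEAST n. \<exists>ss. length ss = n \<and> set ss \<subseteq> S \<and>
        inv\<^bsub>G\<^esub> x \<otimes>\<^bsub>G\<^esub> y = foldr (\<otimes>\<^bsub>G\<^esub>) ss \<one>\<^bsub>G\<^esub>)"

text \<open>The sample space carries the independent uniform steps; the step called \<open>s\<^bsub>t+1\<^esub>\<close> in the
  usual numbering from 1 is the coordinate \<open>s t\<close>.\<close>

definition step_space :: "'a set \<Rightarrow> (nat \<Rightarrow> 'a) measure" where
  "step_space S = (\<Pi>\<^sub>M t\<in>UNIV. uniform_count_measure S)"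

primrec random_walk :: "('a, 'm) monoid_scheme \<Rightarrow> nat \<Rightarrow> (nat \<Rightarrow> 'a) \<Rightarrow> 'a" where
  "random_walk G 0 s = \<one>\<^bsub>G\<^esub>"
| "random_walk G (Suc t) s = random_walk G t s \<otimes>\<^bsub>G\<^esub> s t"


section \<open>Markov type\<close>

text \<open>A Markov chain is represented by its law \<open>P\<close> on the path space \<open>{1..n}\<^sup>\<nat>\<close>, so that \<open>Z\<^sub>t\<close> is
  the coordinate map \<open>\<omega> \<mapsto> \<omega> t\<close>. The Markov property is written multiplicatively because
  conditional probabilities given null events are undefined; rows of \<open>a\<close> that belong to states
  which are never visited are arbitrary probability vectors.\<close>

definition markov_chain :: "nat \<Rightarrow> (nat \<Rightarrow> nat) measure \<Rightarrow> (nat \<Rightarrow> nat \<Rightarrow> real) \<Rightarrow> bool" where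
  "markov_chain n P a \<longleftrightarrow>
     prob_space P \<and>
     sets P = sets (\<Pi>\<^sub>M t\<in>UNIV. count_space {1..n}) \<and>
     (\<forall>i\<in>{1..n}. \<forall>j\<in>{1..n}. 0 \<le> a i j) \<and>
     (\<forall>i\<in>{1..n}. (\<Sum>j=1..n. a i j) = 1) \<and>
     (\<forall>t. \<forall>z \<in> UNIV \<rightarrow> {1..n}.
        measure P {\<omega> \<in> space P. \<forall>k\<le>Suc t. \<omega> k = z k} =
        measure P {\<omega> \<in> space P. \<forall>k\<le>t. \<omega> k = z k} * a (z t) (z (Suc t)))"

definition stationary :: "nat \<Rightarrow> (nat \<Rightarrow> nat) measure \<Rightarrow> bool" where
  "stationary n P \<longleftrightarrow>
     (\<forall>i\<in>{1..n}. \<forall>t. measure P {\<omega> \<in> space P. \<omega> t = i} = measure P {\<omega> \<in> space P. \<omega> 0 = i})"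

definition reversible :: "nat \<Rightarrow> (nat \<Rightarrow> nat) measure \<Rightarrow> (nat \<Rightarrow> nat \<Rightarrow> real) \<Rightarrow> bool" where
  "reversible n P a \<longleftrightarrow>
     (\<forall>i\<in>{1..n}. \<forall>j\<in>{1..n}.
        measure P {\<omega> \<in> space P. \<omega> 0 = i} * a i j = measure P {\<omega> \<in> space P. \<omega> 0 = j} * a j i)"

definition markov_type_with :: "real \<Rightarrow> 'b set \<Rightarrow> ('b \<Rightarrow> 'b \<Rightarrow> real) \<Rightarrow> real \<Rightarrow> bool" where
  "markov_type_with p X d K \<longleftrightarrow>
     (\<forall>n P a f t. markov_chain n P a \<and> stationary n P \<and> reversible n P a \<and>
        f \<in> {1..n} \<rightarrow> X \<and> 1 \<le> t \<longrightarrow>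
        (\<integral>\<omega>. d (f (\<omega> t)) (f (\<omega> 0)) powr p \<partial>P)
          \<le> K powr p * real t * (\<integral>\<omega>. d (f (\<omega> 1)) (f (\<omega> 0)) powr p \<partial>P))"

definition markov_type :: "real \<Rightarrow> 'b set \<Rightarrow> ('b \<Rightarrow> 'b \<Rightarrow> real) \<Rightarrow> bool" where
  "markov_type p X d \<longleftrightarrow> (\<exists>K>0. markov_type_with p X d K)"

text \<open>The infimum is a minimum as soon as \<open>X\<close> has two distinct points. If \<open>X\<close> is a singleton, then
  every \<open>K > 0\<close> is admissible and the constant is \<open>0\<close>.\<close>

definition markov_type_const :: "real \<Rightarrow> 'b set \<Rightarrow> ('b \<Rightarrow> 'b \<Rightarrow> real) \<Rightarrow> real" where
  "markov_type_const p X d = Inf {K. 0 < K \<and> markov_type_with p X d K}"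


section \<open>Hilbert compression exponent\<close>

text \<open>\<open>L\<^sub>2\<close> is \<open>L\<^sub>2([0,1])\<close> with real scalars; its elements are given by representatives, so a map
  into \<open>L\<^sub>2\<close> is a choice of representatives, and \<open>L2_norm\<close> is a seminorm on these.\<close>

definition L2_space :: "(real \<Rightarrow> real) set" where
  "L2_space = {g \<in> borel_measurable lborel. set_integrable lborel {0..1} (\<lambda>u. (g u)\<^sup>2)}"

definition L2_norm :: "(real \<Rightarrow> real) \<Rightarrow> real" where
  "L2_norm g = sqrt (LINT u:{0..1}|lborel. (g u)\<^sup>2)"

text \<open>The supremum is taken in \<open>[0,\<infinity>]\<close>: it is \<open>\<infinity>\<close> for finite groups. In particular the value of
  \<open>0\<^sup>0\<close> (which is \<open>0\<close> for \<open>powr\<close>) in the case \<open>\<alpha> = 0\<close>, \<open>x = y\<close> is immaterial.\<close>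

definition hilbert_compression_exponent :: "('a, 'm) monoid_scheme \<Rightarrow> 'a set \<Rightarrow> ennreal" where
  "hilbert_compression_exponent G S =
     (SUP \<alpha> \<in> {\<alpha>::real. 0 \<le> \<alpha> \<and>
        (\<exists>f \<in> carrier G \<rightarrow> L2_space. \<exists>c>0.
           (\<forall>x\<in>carrier G. \<forall>y\<in>carrier G.
              L2_norm (\<lambda>u. f x u - f y u) \<le> real (word_dist G S x y)) \<and>
           (\<forall>x\<in>carrier G. \<forall>y\<in>carrier G.
              c * real (word_dist G S x y) powr \<alpha> \<le> L2_norm (\<lambda>u. f x u - f y u)))}.
      ennreal \<alpha>)"

end

theory Submission
  imports Defs
begin

text \<open>A chain that follows the random walk inside a finite set \<open>U\<close>, and stays put whenever a step would
  leave \<open>U\<close>, is stationary and reversible for the uniform distribution on \<open>U\<close>, because \<open>S\<close> is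
  symmetric. Markov type \<open>p\<close>, applied to \<open>f\<close> along this chain, bounds the mean of the \<open>p\<close>-th power of
  the displacement at time \<open>t\<close> by \<open>K\<^sup>p t\<close>, since \<open>f\<close> is 1-Lipschitz and one step moves by distance at
  most 1. If \<open>U\<close> is a Folner set, then most starting points lie so deep inside \<open>U\<close> that the chain
  agrees with the random walk up to time \<open>t\<close>. From these points the walk reaches distance \<open>c t\<^sup>\<beta>\<close>
  with probability at least \<open>\<delta>\<close>, so the displacement of \<open>f\<close> is at least \<open>\<rho> (c t\<^sup>\<beta>)\<close> with that
  probability. Hence \<open>\<delta> \<rho>(c t\<^sup>\<beta>)\<^sup>p \<le> K\<^sup>p t\<close>, which is the first claim
  (\<open>markov_type_random_walk\<close>, \<open>compression_speed_bound\<close>).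

  Amenability is given by an invariant mean, and Folner sets have to be extracted from it. If every
  finite set were doubled by multiplication with a fixed finite set \<open>T\<close>, then Hall's theorem would
  yield a paradoxical decomposition of the group, which no invariant mean survives
  (\<open>hall_infinite\<close>, \<open>amenable_not_doubling\<close>). A finite set that is not doubled by a high power of \<open>T\<close>
  grows by a factor close to 1 at one of the intermediate powers
  (\<open>amenable_left_Folner\<close>).

  For the compression exponent, \<open>L\<^sub>2\<close> has Markov type 2 with constant 1 (\<open>L2_markov_type_2\<close>). For
  scalar functions this says that \<open>1 - A\<^sup>t \<le> t (1 - A)\<close> for a self-adjoint contraction \<open>A\<close>, and the
  general case follows by integration. A compression function \<open>b x\<^sup>\<alpha>\<close> therefore satisfies
  \<open>t powr (\<alpha> * \<beta>) = O(sqrt t)\<close>, so \<open>\<alpha> \<beta> \<le> 1/2\<close>.\<close>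

section \<open>Hall's theorem for infinite families of finite sets\<close>

text \<open>Edges are deleted as long as Hall's condition persists; since the sets are finite, Hall's condition
  for a fixed finite \<open>J\<close> only sees finitely many edges and therefore survives unions of chains of
  deletions, so that Zorn's lemma applies. By Rado's argument, no vertex \<open>i\<close> keeps two edges after a
  maximal deletion, and what is left is the graph of an injection.\<close>

lemma hall_infinite:
  fixes A :: "'i \<Rightarrow> 'v set"
  assumes fin: "\<And>i. i \<in> I \<Longrightarrow> finite (A i)"
    and hall: "\<And>J. finite J \<Longrightarrow> J \<subseteq> I \<Longrightarrow> card J \<le> card (\<Union>(A ` J))"
  shows "\<exists>\<phi>. inj_on \<phi> I \<and> (\<forall>i\<in>I. \<phi> i \<in> A i)"
proof -
  define B where "B D i = {v \<in> A i. (i, v) \<notin> D}" for D i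
  define H where "H = {D. \<forall>J. finite J \<and> J \<subseteq> I \<longrightarrow> card J \<le> card (\<Union>(B D ` J))}"
  have "\<exists>M\<in>H. \<forall>X\<in>H. M \<subseteq> X \<longrightarrow> X = M"
  proof (rule subset_Zorn_nonempty)
    have "{} \<in> H" using hall by (auto simp: H_def B_def)
    then show "H \<noteq> {}" by blast
  next
    fix C assume C: "C \<noteq> {}" "subset.chain H C"
    have "card J \<le> card (\<Union>(B (\<Union>C) ` J))" if J: "finite J" "J \<subseteq> I" for J
    proof -
      have "finite (Sigma J A \<inter> \<Union>C)"
        using J fin by (intro finite_Int disjI1 finite_SigmaI) auto
      then obtain D where D: "D \<in> C" "Sigma J A \<inter> \<Union>C \<subseteq> D"
        by (rule finite_subset_Union_chain[OF _ _ C]) auto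
      then have "B (\<Union>C) j = B D j" if "j \<in> J" for j
        using that by (auto simp: B_def)
      moreover have "D \<in> H"
        using C D by (auto simp: subset.chain_def)
      ultimately show ?thesis
        using J by (auto simp: H_def)
    qed
    then show "\<Union>C \<in> H"
      by (auto simp: H_def)
  qed
  then obtain D where D: "D \<in> H" and max: "\<And>X. X \<in> H \<Longrightarrow> D \<subseteq> X \<Longrightarrow> X = D"
    by blast
  define N where "N J = \<Union>(B D ` J)" for J
  have hallD: "card J \<le> card (N J)" if "finite J" "J \<subseteq> I" for J
    using D that by (auto simp: H_def N_def)
  have finN: "finite (N J)" if "finite J" "J \<subseteq> I" for J
    using that fin by (auto simp: N_def B_def)
  \<comment> \<open>Maximality: deleting one more edge \<open>(i, x)\<close> violates Hall's condition on some set, which must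
    contain \<open>i\<close>; here \<open>J\<close> is that set without \<open>i\<close>.\<close>
  have tight: "\<exists>J. finite J \<and> J \<subseteq> I \<and> i \<notin> J \<and> card (N J \<union> (B D i - {x})) \<le> card J"
    if i: "i \<in> I" and x: "x \<in> B D i" for i x
  proof -
    have "insert (i, x) D \<notin> H"
      using max[of "insert (i, x) D"] x by (auto simp: B_def)
    then obtain J where J: "finite J" "J \<subseteq> I" "card (\<Union>(B (insert (i, x) D) ` J)) < card J"
      by (auto simp: H_def not_le)
    have other: "\<Union>(B (insert (i, x) D) ` L) = N L" if "i \<notin> L" for L
    proof -
      have "B (insert (i, x) D) j = B D j" if "j \<in> L" for j
        using that \<open>i \<notin> L\<close> by (auto simp: B_def)
      then show ?thesis by (simp add: N_def)
    qed
    have same: "B (insert (i, x) D) i = B D i - {x}"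
      by (auto simp: B_def)
    have "i \<in> J"
    proof (rule ccontr)
      assume "i \<notin> J"
      with J other[of J] hallD[of J] show False by simp
    qed
    have "\<Union>(B (insert (i, x) D) ` J) = N (J - {i}) \<union> (B D i - {x})"
    proof -
      have "\<Union>(B (insert (i, x) D) ` J)
          = \<Union>(B (insert (i, x) D) ` (J - {i})) \<union> B (insert (i, x) D) i"
        using \<open>i \<in> J\<close> by blast
      then show ?thesis using same other by simp
    qed
    then have "card (N (J - {i}) \<union> (B D i - {x})) \<le> card (J - {i})"
      using J \<open>i \<in> J\<close> by (simp add: card_Diff_singleton)
    with J show ?thesis by (intro exI[of _ "J - {i}"]) auto
  qed
  \<comment> \<open>Two remaining edges at \<open>i\<close> contradict the submodularity of \<open>card \<circ> N\<close>.\<close>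
  have unique: "x = y" if i: "i \<in> I" and x: "x \<in> B D i" and y: "y \<in> B D i" for i x y
  proof (rule ccontr)
    assume "x \<noteq> y"
    obtain J where J: "finite J" "J \<subseteq> I" "i \<notin> J" "card (N J \<union> (B D i - {x})) \<le> card J"
      using tight[OF i x] by blast
    obtain L where L: "finite L" "L \<subseteq> I" "i \<notin> L" "card (N L \<union> (B D i - {y})) \<le> card L"
      using tight[OF i y] by blast
    let ?P = "N J \<union> (B D i - {x})" and ?Q = "N L \<union> (B D i - {y})"
    have fP: "finite ?P" "finite ?Q"
      using finN J L fin[OF i] by (auto simp: B_def)
    have "Suc (card (J \<union> L)) = card (insert i (J \<union> L))"
      using J L by simp
    also have "\<dots> \<le> card (N (insert i (J \<union> L)))"
      using J L i by (intro hallD) auto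
    also have "N (insert i (J \<union> L)) = ?P \<union> ?Q"
      using \<open>x \<noteq> y\<close> by (auto simp: N_def)
    finally have un: "Suc (card (J \<union> L)) \<le> card (?P \<union> ?Q)" .
    have "card (J \<inter> L) \<le> card (N (J \<inter> L))"
      using J L by (intro hallD) auto
    also have "\<dots> \<le> card (?P \<inter> ?Q)"
      using fP by (intro card_mono) (auto simp: N_def)
    finally have int: "card (J \<inter> L) \<le> card (?P \<inter> ?Q)" .
    have "card (?P \<union> ?Q) + card (?P \<inter> ?Q) = card ?P + card ?Q"
      using card_Un_Int[OF fP] by simp
    moreover have "card (J \<union> L) + card (J \<inter> L) = card J + card L"
      using card_Un_Int[OF J(1) L(1)] by simp
    ultimately show False
      using un int J L by linarith
  qed
  have nonempty: "B D i \<noteq> {}" if "i \<in> I" for i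
    using hallD[of "{i}"] that by (auto simp: N_def)
  define \<phi> where "\<phi> i = (SOME v. v \<in> B D i)" for i
  have \<phi>: "\<phi> i \<in> B D i" if "i \<in> I" for i
    unfolding \<phi>_def using nonempty[OF that] by (simp add: some_in_eq)
  then have single: "B D i = {\<phi> i}" if "i \<in> I" for i
    using unique that by blast
  have "inj_on \<phi> I"
  proof (rule inj_onI, rule ccontr)
    fix i j assume ij: "i \<in> I" "j \<in> I" "\<phi> i = \<phi> j" "i \<noteq> j"
    then have "N {i, j} = {\<phi> i}"
      using single by (auto simp: N_def)
    with hallD[of "{i, j}"] ij show False by simp
  qed
  moreover have "\<forall>i\<in>I. \<phi> i \<in> A i"
    using \<phi> by (auto simp: B_def)
  ultimately show ?thesis by blast
qed

section \<open>Amenable groups do not expand\<close>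

lemma finitely_additive_UN:
  fixes \<mu> :: "'x set \<Rightarrow> real"
  assumes add: "\<forall>A \<subseteq> X. \<forall>B \<subseteq> X. A \<inter> B = {} \<longrightarrow> \<mu> (A \<union> B) = \<mu> A + \<mu> B"
    and "finite K" "\<And>k. k \<in> K \<Longrightarrow> A k \<subseteq> X" "disjoint_family_on A K"
  shows "\<mu> (\<Union>k\<in>K. A k) = (\<Sum>k\<in>K. \<mu> (A k))"
  using assms(2-)
proof (induction K)
  case empty
  have "\<mu> ({} \<union> {}) = \<mu> {} + \<mu> {}" using add by blast
  then show ?case by simp
next
  case (insert k K)
  have "\<mu> (A k \<union> (\<Union>k\<in>K. A k)) = \<mu> (A k) + \<mu> (\<Union>k\<in>K. A k)"
    using insert.prems insert.hyps by (intro add[rule_format]) (auto simp: disjoint_family_on_def)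
  also have "\<mu> (\<Union>k\<in>K. A k) = (\<Sum>k\<in>K. \<mu> (A k))"
    using insert.prems by (intro insert.IH) (auto simp: disjoint_family_on_def)
  finally show ?case using insert.hyps by simp
qed

text \<open>The map \<open>\<psi>\<close> is a left translation on each of the finitely many pieces \<open>{x. \<psi> x = k \<otimes> x}\<close>, and the
  images of the pieces are disjoint again.\<close>

lemma (in group) invariant_mean_piecewise_translation:
  fixes \<mu> :: "'a set \<Rightarrow> real"
  assumes add: "\<forall>A \<subseteq> carrier G. \<forall>B \<subseteq> carrier G. A \<inter> B = {} \<longrightarrow> \<mu> (A \<union> B) = \<mu> A + \<mu> B"
    and inv: "\<forall>g \<in> carrier G. \<forall>A \<subseteq> carrier G. \<mu> (g <# A) = \<mu> A"
    and T: "finite T" "T \<subseteq> carrier G"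
    and \<psi>: "inj_on \<psi> (carrier G)" "\<And>x. x \<in> carrier G \<Longrightarrow> \<psi> x \<in> (\<lambda>k. k \<otimes> x) ` T"
  shows "\<mu> (\<psi> ` carrier G) = \<mu> (carrier G)"
proof -
  define A where "A k = {x \<in> carrier G. \<psi> x = k \<otimes> x}" for k
  have A: "A k \<subseteq> carrier G" for k by (auto simp: A_def)
  have image: "k <# A k = \<psi> ` A k" for k
    by (auto simp: A_def l_coset_def)
  have "A k \<inter> A l = {}" if "k \<in> T" "l \<in> T" "k \<noteq> l" for k l
  proof -
    have "k \<in> carrier G" "l \<in> carrier G" using that T by auto
    with \<open>k \<noteq> l\<close> show ?thesis by (auto simp: A_def)
  qed
  then have disj: "disjoint_family_on A T"
    by (simp add: disjoint_family_on_def)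
  then have disj': "disjoint_family_on (\<lambda>k. k <# A k) T"
    unfolding image disjoint_family_on_def
    using inj_on_image_Int[OF \<psi>(1) A A] by (metis image_empty)
  have carrier: "(\<Union>k\<in>T. A k) = carrier G"
    using \<psi>(2) by (fastforce simp: A_def)
  have "\<mu> (carrier G) = (\<Sum>k\<in>T. \<mu> (A k))"
    using finitely_additive_UN[OF add T(1) A disj] carrier by simp
  also have "\<dots> = (\<Sum>k\<in>T. \<mu> (k <# A k))"
    using inv T A by (intro sum.cong) auto
  also have "\<dots> = \<mu> (\<Union>k\<in>T. k <# A k)"
    using T A by (intro finitely_additive_UN[OF add T(1) _ disj', symmetric])
      (auto simp: l_coset_def subset_iff)
  also have "(\<Union>k\<in>T. k <# A k) = \<psi> ` carrier G"
    unfolding image carrier[symmetric] by blast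
  finally show ?thesis by simp
qed

text \<open>Otherwise Hall's theorem embeds two disjoint copies of the group into the group in such a way that
  every point is moved by an element of \<open>T\<close>. Each copy is the image of the group under a piecewise
  translation and has mean 1, so that the whole group would have mean at least 2.\<close>

lemma (in group) amenable_not_doubling:
  assumes "amenable G" and T: "finite T" "T \<subseteq> carrier G"
  shows "\<exists>F. finite F \<and> F \<noteq> {} \<and> F \<subseteq> carrier G \<and> card (T <#> F) < 2 * card F"
proof (rule ccontr)
  assume "\<not> ?thesis"
  then have doubling: "2 * card F \<le> card (T <#> F)" if "finite F" "F \<noteq> {}" "F \<subseteq> carrier G" for F
    using that by (meson not_le)
  obtain \<mu> :: "'a set \<Rightarrow> real" where \<mu>: "\<forall>A \<subseteq> carrier G. 0 \<le> \<mu> A" "\<mu> (carrier G) = 1"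
    "\<forall>A \<subseteq> carrier G. \<forall>B \<subseteq> carrier G. A \<inter> B = {} \<longrightarrow> \<mu> (A \<union> B) = \<mu> A + \<mu> B"
    "\<forall>g \<in> carrier G. \<forall>A \<subseteq> carrier G. \<mu> (g <# A) = \<mu> A"
    using \<open>amenable G\<close> unfolding amenable_def by (elim exE conjE) (rule that)
  \<comment> \<open>The Boolean component distinguishes the two copies.\<close>
  let ?I = "carrier G \<times> (UNIV :: bool set)"
  have "\<exists>\<phi>. inj_on \<phi> ?I \<and> (\<forall>i\<in>?I. \<phi> i \<in> (\<lambda>k. k \<otimes> fst i) ` T)"
  proof (rule hall_infinite)
    fix J assume J: "finite J" "J \<subseteq> ?I"
    show "card J \<le> card (\<Union>i\<in>J. (\<lambda>k. k \<otimes> fst i) ` T)"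
    proof (cases "J = {}")
      case False
      have "card J \<le> card (fst ` J \<times> (UNIV :: bool set))"
        using J by (intro card_mono) (auto intro: rev_image_eqI)
      also have "\<dots> = 2 * card (fst ` J)"
        by (simp add: card_cartesian_product card_UNIV_bool)
      also have "\<dots> \<le> card (T <#> fst ` J)"
        using J False by (intro doubling) auto
      also have "T <#> fst ` J = (\<Union>i\<in>J. (\<lambda>k. k \<otimes> fst i) ` T)"
        by (auto simp: set_mult_def)
      finally show ?thesis .
    qed simp
  qed (use T in auto)
  then obtain \<phi> where \<phi>: "inj_on \<phi> ?I" "\<forall>i\<in>?I. \<phi> i \<in> (\<lambda>k. k \<otimes> fst i) ` T"
    by blast
  have \<phi>_in: "\<phi> (x, b) \<in> (\<lambda>k. k \<otimes> x) ` T" if "x \<in> carrier G" for x b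
    using \<phi>(2)[rule_format, of "(x, b)"] that by simp
  have \<phi>_inj: "inj_on (\<lambda>x. \<phi> (x, b)) (carrier G)" for b
    using \<phi>(1) by (auto simp: inj_on_def)
  have copy: "\<mu> ((\<lambda>x. \<phi> (x, b)) ` carrier G) = 1" for b
    using invariant_mean_piecewise_translation[OF \<mu>(3,4) T \<phi>_inj \<phi>_in] \<mu>(2) by simp
  define C where "C b = (\<lambda>x. \<phi> (x, b)) ` carrier G" for b
  have C: "C b \<subseteq> carrier G" for b
  proof
    fix y assume "y \<in> C b"
    then obtain x where "x \<in> carrier G" "y = \<phi> (x, b)" by (auto simp: C_def)
    with \<phi>_in[of x b] T show "y \<in> carrier G" by auto
  qed
  have "C True \<inter> C False = {}"
    using \<phi>(1) by (auto simp: C_def dest: inj_onD)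
  then have "\<mu> (C True \<union> C False) = 2"
    using \<mu>(3) C copy by (auto simp: C_def)
  moreover have "\<mu> ((C True \<union> C False) \<union> (carrier G - (C True \<union> C False)))
      = \<mu> (C True \<union> C False) + \<mu> (carrier G - (C True \<union> C False))"
    using C by (intro \<mu>(3)[rule_format]) auto
  moreover have "(C True \<union> C False) \<union> (carrier G - (C True \<union> C False)) = carrier G"
    using C by auto
  moreover have "0 \<le> \<mu> (carrier G - (C True \<union> C False))"
    using \<mu>(1) by (metis Diff_subset)
  ultimately show False
    using \<mu>(2) by simp
qed

lemma (in group) finite_set_mult:
  assumes "finite A" "finite B"
  shows "finite (A <#> B)"
  using assms by (auto simp: set_mult_def)

text \<open>The sets \<open>T\<^sup>k F\<close> increase with \<open>k\<close> once \<open>\<one>\<close> is adjoined to \<open>T\<close>. If \<open>T\<^sup>N F\<close> has less than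
  \<open>2 |F|\<close> elements, where \<open>q\<^sup>N < 1/2\<close>, then not all of the first \<open>N\<close> steps can enlarge the set
  by a factor above \<open>1/q\<close>.\<close>

lemma (in group) amenable_left_Folner:
  assumes "amenable G" and T: "finite T" "T \<subseteq> carrier G" and q: "0 < q" "q < (1 :: real)"
  shows "\<exists>V U. finite V \<and> V \<noteq> {} \<and> V \<subseteq> U \<and> finite U \<and> U \<subseteq> carrier G \<and> T <#> V \<subseteq> U
    \<and> q * card U \<le> card V"
proof -
  define T' where "T' = insert \<one> T"
  have T': "finite T'" "T' \<subseteq> carrier G" "\<one> \<in> T'"
    using T by (auto simp: T'_def)
  define P where "P k = ((\<lambda>A. T' <#> A) ^^ k) {\<one>}" for k
  have P_Suc: "P (Suc k) = T' <#> P k" and P_0: "P 0 = {\<one>}" for k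
    by (simp_all add: P_def)
  have P: "finite (P k) \<and> P k \<subseteq> carrier G" for k
  proof (induction k)
    case (Suc k)
    then show ?case
      using finite_set_mult[OF T'(1), of "P k"] set_mult_closed[OF T'(2), of "P k"]
      by (simp add: P_Suc)
  qed (simp add: P_0)
  obtain N where N: "q ^ N < 1 / 2"
    using real_arch_pow_inv[of "1/2" q] q by auto
  obtain F where F: "finite F" "F \<noteq> {}" "F \<subseteq> carrier G" "card (P N <#> F) < 2 * card F"
    using amenable_not_doubling[OF \<open>amenable G\<close>, of "P N"] P[of N] by auto
  define V where "V k = P k <#> F" for k
  have V: "finite (V k)" "V k \<subseteq> carrier G" for k
    using finite_set_mult[OF _ F(1), of "P k"] set_mult_closed[OF _ F(3), of "P k"] P[of k]
    by (simp_all add: V_def)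
  have V_Suc: "V (Suc k) = T' <#> V k" for k
    using set_mult_assoc[OF T'(2) conjunct2[OF P] F(3)] by (simp add: V_def P_Suc)
  have V_0: "V 0 = F"
    using lcos_mult_one[OF F(3)] by (simp add: V_def P_0 l_coset_eq_set_mult)
  have V_mono: "V k \<subseteq> V (Suc k)" for k
  proof
    fix x assume "x \<in> V k"
    then have "\<one> \<otimes> x \<in> T' <#> V k"
      using T'(3) unfolding set_mult_def by blast
    with \<open>x \<in> V k\<close> V(2)[of k] show "x \<in> V (Suc k)"
      by (auto simp: V_Suc)
  qed
  have V_ne: "V k \<noteq> {}" for k
  proof (induction k)
    case (Suc k)
    with V_mono[of k] show ?case by auto
  qed (simp add: V_0 F(2))
  have "\<exists>k. q * card (V (Suc k)) \<le> card (V k)"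
  proof (rule ccontr)
    assume "\<not> ?thesis"
    then have small: "real (card (V k)) < q * card (V (Suc k))" for k
      by (meson not_le)
    have "real (card F) \<le> q ^ k * card (V k)" for k
    proof (induction k)
      case 0
      then show ?case by (simp add: V_0)
    next
      case (Suc k)
      have "q ^ k * card (V k) \<le> q ^ k * (q * card (V (Suc k)))"
        using small[of k] q by (intro mult_left_mono) auto
      with Suc show ?case by (simp add: mult_ac)
    qed
    from this[of N] have "real (card F) \<le> q ^ N * card (V N)" .
    also have "\<dots> \<le> 1 / 2 * card (V N)"
      using N by (intro mult_right_mono) auto
    also have "\<dots> < card F"
      using F(4) by (simp add: V_def)
    finally show False by simp
  qed
  then obtain k where k: "q * card (V (Suc k)) \<le> card (V k)" by blast
  have "T <#> V k \<subseteq> V (Suc k)"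
    unfolding V_Suc by (intro mono_set_mult) (auto simp: T'_def)
  with k show ?thesis
    by (intro exI[of _ "V k"] exI[of _ "V (Suc k)"] conjI V V_ne V_mono)
qed

text \<open>The mean is invariant under left translations, but the random walk multiplies on the right.
  Inversion exchanges the two sides.\<close>

lemma (in group) amenable_right_Folner:
  assumes "amenable G" and T: "finite T" "T \<subseteq> carrier G" and q: "0 < q" "q < (1 :: real)"
  shows "\<exists>V U. finite V \<and> V \<noteq> {} \<and> V \<subseteq> U \<and> finite U \<and> U \<subseteq> carrier G \<and> V <#> T \<subseteq> U
    \<and> q * card U \<le> card V"
proof -
  let ?i = "\<lambda>x. inv x"
  have inj: "inj_on ?i A" if "A \<subseteq> carrier G" for A
    using that by (rule inj_on_subset[OF inv_inj])
  obtain V U where VU: "finite V" "V \<noteq> {}" "V \<subseteq> U" "finite U" "U \<subseteq> carrier G"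
    "?i ` T <#> V \<subseteq> U" "q * card U \<le> card V"
  proof -
    have "finite (?i ` T)" "?i ` T \<subseteq> carrier G" using T by auto
    from amenable_left_Folner[OF \<open>amenable G\<close> this q] show thesis
      by (elim exE conjE) (rule that)
  qed
  have "?i ` V <#> T \<subseteq> ?i ` U"
  proof
    fix z assume "z \<in> ?i ` V <#> T"
    then obtain v t where vt: "v \<in> V" "t \<in> T" "z = inv v \<otimes> t"
      by (auto simp: set_mult_def)
    then have "v \<in> carrier G" "t \<in> carrier G" using VU T by auto
    then have "z = inv (inv t \<otimes> v)" using vt by (simp add: inv_mult_group)
    moreover have "inv t \<otimes> v \<in> U" using VU(6) vt by (auto simp: set_mult_def)
    ultimately show "z \<in> ?i ` U" by blast
  qed
  moreover have "card (?i ` V) = card V" "card (?i ` U) = card U"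
    using VU by (auto intro!: card_image inj)
  ultimately show ?thesis
    using VU by (intro exI[of _ "?i ` V"] exI[of _ "?i ` U"]) auto
qed

section \<open>Chains driven by independent uniform steps\<close>

lemma space_step_space: "space (step_space S) = (UNIV \<rightarrow> S)"
  by (simp add: step_space_def space_PiM space_uniform_count_measure PiE_UNIV_domain)

lemma prob_space_step_space:
  assumes "finite S" "S \<noteq> {}"
  shows "prob_space (step_space S)"
  unfolding step_space_def using assms
  by (intro prob_space_PiM prob_space_uniform_count_measure)

lemma measurable_step_space_prefix:
  "{s \<in> space (step_space S). \<forall>i<t. s i = w i} \<in> sets (step_space S)"
proof -
  have "{s \<in> space (step_space S). s i = w i} \<in> sets (step_space S)" for i
  proof -
    have "{x \<in> space (uniform_count_measure S). x = w i} \<in> sets (uniform_count_measure S)"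
      by (auto simp: space_uniform_count_measure sets_uniform_count_measure)
    then show ?thesis
      unfolding step_space_def
      using sets_Collect_single'[of i UNIV "\<lambda>_. uniform_count_measure S" "\<lambda>x. x = w i"] by simp
  qed
  then have "{s \<in> space (step_space S). \<forall>i\<in>{..<t}. s i = w i} \<in> sets (step_space S)"
    by (rule sets.sets_Collect_countable_Ball)
  then show ?thesis unfolding Ball_def lessThan_iff .
qed

lemma measure_step_space_prefix:
  assumes "finite S" "S \<noteq> {}" "w \<in> UNIV \<rightarrow> S"
  shows "measure (step_space S) {s \<in> space (step_space S). \<forall>i<t. s i = w i} = (1 / card S) ^ t"
proof -
  interpret prob_space "uniform_count_measure S"
    using assms by (intro prob_space_uniform_count_measure)
  interpret P: product_prob_space "\<lambda>_. uniform_count_measure S" "UNIV :: nat set"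
    by unfold_locales
  have "{s \<in> space (step_space S). \<forall>i<t. s i = w i}
      = prod_emb UNIV (\<lambda>_. uniform_count_measure S) {..<t} (\<Pi>\<^sub>E i\<in>{..<t}. {w i})"
    by (auto simp: prod_emb_def step_space_def space_PiM restrict_PiE_iff PiE_UNIV_domain Pi_iff)
  then have "measure (step_space S) {s \<in> space (step_space S). \<forall>i<t. s i = w i}
      = (\<Prod>i<t. measure (uniform_count_measure S) {w i})"
    using assms P.measure_PiM_emb[of "{..<t}" "\<lambda>i. {w i}"]
    by (simp add: step_space_def sets_uniform_count_measure Pi_iff)
  also have "\<dots> = (\<Prod>i<t. 1 / card S)"
    using assms by (intro prod.cong) (auto simp: measure_uniform_count_measure Pi_iff)
  finally show ?thesis by simp
qed

text \<open>Events about the steps before time \<open>t\<close>, described pointwise instead of by a \<open>\<sigma>\<close>-algebra. Only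
  \<open>S\<close>-valued sequences are compared because these form the sample space.\<close>

definition depends_on_prefix :: "nat \<Rightarrow> 'a set \<Rightarrow> ((nat \<Rightarrow> 'a) \<Rightarrow> bool) \<Rightarrow> bool" where
  "depends_on_prefix t S Q \<longleftrightarrow>
     (\<forall>s \<in> UNIV \<rightarrow> S. \<forall>s' \<in> UNIV \<rightarrow> S. (\<forall>i<t. s i = s' i) \<longrightarrow> Q s = Q s')"

lemma depends_on_prefixI:
  assumes "\<And>s s'. \<forall>i<t. s i = s' i \<Longrightarrow> Q s = Q s'"
  shows "depends_on_prefix t S Q"
  using assms by (simp add: depends_on_prefix_def)

lemma depends_on_prefixD:
  assumes "depends_on_prefix t S Q" "s \<in> UNIV \<rightarrow> S" "s' \<in> UNIV \<rightarrow> S" "\<forall>i<t. s i = s' i"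
  shows "Q s = Q s'"
  using assms unfolding depends_on_prefix_def by blast

lemma depends_on_prefix_conj:
  assumes "depends_on_prefix t S Q"
  shows "depends_on_prefix (Suc t) S (\<lambda>s. Q s \<and> R (s t))"
  unfolding depends_on_prefix_def
proof (intro ballI impI)
  fix s s' assume "s \<in> UNIV \<rightarrow> S" "s' \<in> UNIV \<rightarrow> S" "\<forall>i<Suc t. s i = s' i"
  then show "(Q s \<and> R (s t)) = (Q s' \<and> R (s' t))"
    using depends_on_prefixD[OF assms, of s s'] by simp
qed

text \<open>An event about the first \<open>t\<close> steps is a finite disjoint union of cylinders. The words in \<open>W\<close> are
  infinite sequences that are constant from time \<open>t\<close> on, so that every cylinder has exactly one
  representative.\<close>

lemma depends_on_prefix_decompose:
  assumes S: "finite S" "S \<noteq> {}" and Q: "depends_on_prefix t S Q"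
  obtains W where "finite W" "W \<subseteq> (UNIV \<rightarrow> S)"
    "{s \<in> space (step_space S). Q s} = (\<Union>w\<in>W. {s \<in> space (step_space S). \<forall>i<t. s i = w i})"
    "\<And>v w. v \<in> W \<Longrightarrow> w \<in> W \<Longrightarrow> \<forall>i<t. v i = w i \<Longrightarrow> v = w"
proof -
  obtain a where a: "a \<in> S" using S by blast
  define W where "W = {w. (\<forall>i. (i \<in> {..<t} \<longrightarrow> w i \<in> S) \<and> (i \<notin> {..<t} \<longrightarrow> w i = a)) \<and> Q w}"
  show thesis
  proof
    show "finite W"
      by (rule finite_subset[OF _ finite_set_of_finite_funs[OF finite_lessThan[of t] S(1), of a]])
        (auto simp: W_def)
    show W: "W \<subseteq> (UNIV \<rightarrow> S)"
    proof
      fix w assume "w \<in> W"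
      then have "w i \<in> S" for i
        using a by (cases "i < t") (auto simp: W_def)
      then show "w \<in> UNIV \<rightarrow> S" by blast
    qed
    show "{s \<in> space (step_space S). Q s} = (\<Union>w\<in>W. {s \<in> space (step_space S). \<forall>i<t. s i = w i})"
    proof (intro equalityI subsetI)
      fix s assume s: "s \<in> {s \<in> space (step_space S). Q s}"
      define w where "w i = (if i < t then s i else a)" for i
      have "w \<in> UNIV \<rightarrow> S"
        using s a by (auto simp: w_def space_step_space)
      then have "Q w = Q s"
        using s by (intro depends_on_prefixD[OF Q]) (auto simp: w_def space_step_space)
      then have "w \<in> W"
        using s by (auto simp: W_def w_def space_step_space)
      then show "s \<in> (\<Union>w\<in>W. {s \<in> space (step_space S). \<forall>i<t. s i = w i})"
        using s by (auto simp: w_def intro!: bexI[of _ w])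
    next
      fix s assume "s \<in> (\<Union>w\<in>W. {s \<in> space (step_space S). \<forall>i<t. s i = w i})"
      then obtain w where w: "w \<in> W" "s \<in> space (step_space S)" "\<forall>i<t. s i = w i" by blast
      then have "Q s = Q w"
        using W by (intro depends_on_prefixD[OF Q]) (auto simp: space_step_space)
      then show "s \<in> {s \<in> space (step_space S). Q s}"
        using w by (auto simp: W_def)
    qed
    show "v = w" if "v \<in> W" "w \<in> W" "\<forall>i<t. v i = w i" for v w
    proof
      fix i show "v i = w i"
        using that by (cases "i < t") (auto simp: W_def)
    qed
  qed
qed

lemma depends_on_prefix_sets:
  assumes "finite S" "S \<noteq> {}" "depends_on_prefix t S Q"
  shows "{s \<in> space (step_space S). Q s} \<in> sets (step_space S)"
proof -
  obtain W where W: "finite W"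
    "{s \<in> space (step_space S). Q s} = (\<Union>w\<in>W. {s \<in> space (step_space S). \<forall>i<t. s i = w i})"
    by (rule depends_on_prefix_decompose[OF assms]) (rule that, assumption+)
  show ?thesis
    unfolding W(2) by (rule sets.finite_UN[OF W(1) measurable_step_space_prefix])
qed

text \<open>The step at time \<open>t\<close> is independent of the past: every cylinder of length \<open>t\<close> splits into
  \<open>card S\<close> equally likely cylinders of length \<open>t + 1\<close>.\<close>

lemma measure_step_space_next:
  assumes S: "finite S" "S \<noteq> {}" and Q: "depends_on_prefix t S Q" and a: "a \<in> S"
  shows "measure (step_space S) {s \<in> space (step_space S). Q s \<and> s t = a}
    = measure (step_space S) {s \<in> space (step_space S). Q s} / card S"
proof -
  interpret prob_space "step_space S" by (rule prob_space_step_space[OF S])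
  obtain W where W: "finite W" "W \<subseteq> (UNIV \<rightarrow> S)"
    "{s \<in> space (step_space S). Q s} = (\<Union>w\<in>W. {s \<in> space (step_space S). \<forall>i<t. s i = w i})"
    "\<And>v w. v \<in> W \<Longrightarrow> w \<in> W \<Longrightarrow> \<forall>i<t. v i = w i \<Longrightarrow> v = w"
    by (rule depends_on_prefix_decompose[OF S Q]) (rule that, assumption+)
  define C where "C w = {s \<in> space (step_space S). \<forall>i<t. s i = w i}" for w
  define C' where "C' w = {s \<in> space (step_space S). \<forall>i<Suc t. s i = (w(t := a)) i}" for w
  have sets: "C w \<in> events" and sets': "C' w \<in> events" for w
    unfolding C_def C'_def by (rule measurable_step_space_prefix)+
  have C'_eq: "C' w = {s \<in> C w. s t = a}" for w
    by (auto simp: C'_def C_def less_Suc_eq)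
  have disj: "disjoint_family_on C W"
    unfolding disjoint_family_on_def
  proof (intro ballI impI equals0I)
    fix v w s assume "v \<in> W" "w \<in> W" "v \<noteq> w" "s \<in> C v \<inter> C w"
    then show False using W(4)[of v w] by (auto simp: C_def)
  qed
  then have disj': "disjoint_family_on C' W"
    by (auto simp: disjoint_family_on_def C'_eq)
  have upd: "w(t := a) \<in> UNIV \<rightarrow> S" if "w \<in> W" for w
    using W(2) a that by (auto simp: Pi_iff)
  have "{s \<in> space (step_space S). Q s \<and> s t = a} = {s \<in> {s \<in> space (step_space S). Q s}. s t = a}"
    by auto
  also have "\<dots> = (\<Union>w\<in>W. C' w)"
    unfolding W(3) C'_eq C_def by blast
  also have "prob \<dots> = (\<Sum>w\<in>W. prob (C' w))"
    using W(1) disj' sets' by (intro finite_measure_finite_Union) auto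
  also have "\<dots> = (\<Sum>w\<in>W. (1 / card S) ^ Suc t)"
    unfolding C'_def by (intro sum.cong measure_step_space_prefix S upd refl)
  also have "\<dots> = (\<Sum>w\<in>W. (1 / card S) ^ t) / card S"
    by (simp add: sum_divide_distrib)
  also have "(\<Sum>w\<in>W. (1 / card S) ^ t) = (\<Sum>w\<in>W. prob (C w))"
    unfolding C_def using S W(2) by (intro sum.cong measure_step_space_prefix[symmetric]) auto
  also have "\<dots> = prob (\<Union>w\<in>W. C w)"
    using W(1) disj sets by (intro finite_measure_finite_Union[symmetric]) auto
  finally show ?thesis unfolding W(3) C_def .
qed

lemma measure_step_space_next_in:
  assumes S: "finite S" "S \<noteq> {}" and Q: "depends_on_prefix t S Q"
  shows "measure (step_space S) {s \<in> space (step_space S). Q s \<and> R (s t)}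
    = measure (step_space S) {s \<in> space (step_space S). Q s} * (card {a \<in> S. R a} / card S)"
proof -
  interpret prob_space "step_space S" by (rule prob_space_step_space[OF S])
  define B where "B a = {s \<in> space (step_space S). Q s \<and> s t = a}" for a
  have sets: "B a \<in> events" for a
    unfolding B_def by (rule depends_on_prefix_sets[OF S depends_on_prefix_conj[OF Q]])
  have "{s \<in> space (step_space S). Q s \<and> R (s t)} = (\<Union>a\<in>{a \<in> S. R a}. B a)"
    by (auto simp: B_def space_step_space)
  also have "prob \<dots> = (\<Sum>a\<in>{a \<in> S. R a}. prob (B a))"
    using S(1) sets by (intro finite_measure_finite_Union) (auto simp: B_def disjoint_family_on_def)
  also have "\<dots> = (\<Sum>a\<in>{a \<in> S. R a}. prob {s \<in> space (step_space S). Q s} / card S)"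
    unfolding B_def using measure_step_space_next[OF S Q] by (intro sum.cong) auto
  finally show ?thesis by simp
qed

text \<open>Every step applies the random self-map \<open>\<lambda>i. \<phi> i (s t)\<close> of the state space. This realizes a Markov
  chain on the sample space of the random walk itself, so that the two can be compared path by path.\<close>

primrec trajectory :: "('i \<Rightarrow> 'a \<Rightarrow> 'i) \<Rightarrow> 'i \<Rightarrow> (nat \<Rightarrow> 'a) \<Rightarrow> nat \<Rightarrow> 'i" where
  "trajectory \<phi> i s 0 = i"
| "trajectory \<phi> i s (Suc t) = \<phi> (trajectory \<phi> i s t) (s t)"

lemma trajectory_cong:
  "(\<And>k. k < t \<Longrightarrow> s k = s' k) \<Longrightarrow> trajectory \<phi> i s t = trajectory \<phi> i s' t"
  by (induction t) auto

lemma depends_on_prefix_trajectory: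
  "depends_on_prefix t S (\<lambda>s. trajectory \<phi> i s t = j)"
  by (rule depends_on_prefixI) (metis trajectory_cong)

lemma depends_on_prefix_trajectories:
  "depends_on_prefix t S (\<lambda>s. \<forall>k\<le>t. trajectory \<phi> i s k = z k)"
proof (rule depends_on_prefixI)
  fix s s' :: "nat \<Rightarrow> 'a" assume "\<forall>k<t. s k = s' k"
  then have "trajectory \<phi> i s k = trajectory \<phi> i s' k" if "k \<le> t" for k
    using that by (intro trajectory_cong) auto
  then show "(\<forall>k\<le>t. trajectory \<phi> i s k = z k) = (\<forall>k\<le>t. trajectory \<phi> i s' k = z k)"
    by simp
qed

definition trajectory_law ::
    "nat \<Rightarrow> 'a set \<Rightarrow> (nat \<Rightarrow> 'a \<Rightarrow> nat) \<Rightarrow> (nat \<Rightarrow> nat) measure" where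
  "trajectory_law n S \<phi> =
     distr (uniform_count_measure {1..n} \<Otimes>\<^sub>M step_space S) (\<Pi>\<^sub>M t\<in>UNIV. count_space {1..n})
       (\<lambda>(i, s). trajectory \<phi> i s)"

definition transition :: "'a set \<Rightarrow> ('i \<Rightarrow> 'a \<Rightarrow> 'i) \<Rightarrow> 'i \<Rightarrow> 'i \<Rightarrow> real" where
  "transition S \<phi> i j = card {a \<in> S. \<phi> i a = j} / card S"

context
  fixes n :: nat and S :: "'a set" and \<phi> :: "nat \<Rightarrow> 'a \<Rightarrow> nat"
  assumes n: "1 \<le> n" and S: "finite S" "S \<noteq> {}"
    and \<phi>: "\<phi> \<in> {1..n} \<rightarrow> S \<rightarrow> {1..n}"
begin

lemma trajectory_in:
  assumes "i \<in> {1..n}" "s \<in> UNIV \<rightarrow> S"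
  shows "trajectory \<phi> i s t \<in> {1..n}"
proof (induction t)
  case (Suc t)
  have "s t \<in> S" using assms(2) by blast
  with \<phi> Suc show ?case by (auto simp: Pi_iff simp del: atLeastAtMost_iff)
qed (use assms in simp)

lemma measurable_trajectory:
  assumes "i \<in> {1..n}"
  shows "trajectory \<phi> i \<in> measurable (step_space S) (\<Pi>\<^sub>M t\<in>UNIV. count_space {1..n})"
proof (rule measurable_PiM_single')
  fix t :: nat
  show "(\<lambda>s. trajectory \<phi> i s t) \<in> measurable (step_space S) (count_space {1..n})"
  proof (subst measurable_count_space_eq2, safe)
    fix s assume "s \<in> space (step_space S)"
    then show "trajectory \<phi> i s t \<in> {1..n}"
      using trajectory_in[OF assms] by (simp add: space_step_space)
  next
    fix j
    show "(\<lambda>s. trajectory \<phi> i s t) -` {j} \<inter> space (step_space S) \<in> sets (step_space S)"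
      using depends_on_prefix_sets[OF S depends_on_prefix_trajectory[where t = t and i = i and j = j and \<phi> = \<phi>]]
      by (simp add: vimage_def Int_def conj_commute)
  qed
qed (use trajectory_in[OF assms] in \<open>auto simp: space_step_space PiE_UNIV_domain\<close>)

lemma measurable_trajectory_pair:
  "(\<lambda>(i, s). trajectory \<phi> i s) \<in> measurable (uniform_count_measure {1..n} \<Otimes>\<^sub>M step_space S)
     (\<Pi>\<^sub>M t\<in>UNIV. count_space {1..n})"
proof -
  have "(\<lambda>(i, s). trajectory \<phi> i s) \<in> measurable (count_space {1..n} \<Otimes>\<^sub>M step_space S)
     (\<Pi>\<^sub>M t\<in>UNIV. count_space {1..n})"
    using measurable_trajectory by (intro measurable_pair_measure_countable1) auto
  also have "measurable (count_space {1..n} \<Otimes>\<^sub>M step_space S) (\<Pi>\<^sub>M t\<in>UNIV. count_space {1..n})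
      = measurable (uniform_count_measure {1..n} \<Otimes>\<^sub>M step_space S)
          (\<Pi>\<^sub>M t\<in>UNIV. count_space {1..n})"
    by (intro measurable_cong_sets sets_pair_measure_cong sets_uniform_count_measure_count_space[symmetric] refl)
  finally show ?thesis .
qed

lemma space_trajectory_law: "space (trajectory_law n S \<phi>) = UNIV \<rightarrow> {1..n}"
  by (simp add: trajectory_law_def space_PiM PiE_UNIV_domain)

lemma sets_trajectory_law: "sets (trajectory_law n S \<phi>) = sets (\<Pi>\<^sub>M t\<in>UNIV. count_space {1..n})"
  by (simp add: trajectory_law_def)

lemma prob_space_trajectory_law: "prob_space (trajectory_law n S \<phi>)"
proof -
  interpret U: prob_space "uniform_count_measure {1..n}"
    using n by (intro prob_space_uniform_count_measure) auto
  interpret P: prob_space "step_space S" by (rule prob_space_step_space[OF S])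
  interpret UP: pair_prob_space "uniform_count_measure {1..n}" "step_space S" ..
  show ?thesis
    unfolding trajectory_law_def by (intro UP.prob_space_distr measurable_trajectory_pair)
qed

lemma integral_trajectory_law:
  fixes F :: "(nat \<Rightarrow> nat) \<Rightarrow> real"
  assumes F: "F \<in> borel_measurable (\<Pi>\<^sub>M t\<in>UNIV. count_space {1..n})"
    and bound: "\<And>\<omega>. \<omega> \<in> UNIV \<rightarrow> {1..n} \<Longrightarrow> \<bar>F \<omega>\<bar> \<le> C"
  shows "(\<integral>\<omega>. F \<omega> \<partial>trajectory_law n S \<phi>)
    = (\<Sum>i=1..n. \<integral>s. F (trajectory \<phi> i s) \<partial>step_space S) / n"
proof -
  interpret U: prob_space "uniform_count_measure {1..n}"
    using n by (intro prob_space_uniform_count_measure) auto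
  interpret P: prob_space "step_space S" by (rule prob_space_step_space[OF S])
  interpret UP: pair_prob_space "uniform_count_measure {1..n}" "step_space S" ..
  let ?M = "uniform_count_measure {1..n} \<Otimes>\<^sub>M step_space S"
  have meas: "(\<lambda>x. F (case x of (i, s) \<Rightarrow> trajectory \<phi> i s)) \<in> borel_measurable ?M"
    using measurable_compose[OF measurable_trajectory_pair F] .
  have int: "integrable ?M (\<lambda>(i, s). F (trajectory \<phi> i s))"
  proof (rule UP.integrable_const_bound[where B = C])
    show "AE x in ?M. norm (case x of (i, s) \<Rightarrow> F (trajectory \<phi> i s)) \<le> C"
    proof (rule AE_I2)
      fix x assume "x \<in> space ?M"
      then obtain i s where x: "x = (i, s)" "i \<in> {1..n}" "s \<in> UNIV \<rightarrow> S"
        by (auto simp: space_pair_measure space_uniform_count_measure space_step_space)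
      then show "norm (case x of (i, s) \<Rightarrow> F (trajectory \<phi> i s)) \<le> C"
        using bound[of "trajectory \<phi> i s"] trajectory_in[OF x(2,3)] by (simp add: Pi_iff)
    qed
    show "(\<lambda>(i, s). F (trajectory \<phi> i s)) \<in> borel_measurable ?M"
      using meas by (simp add: case_prod_unfold)
  qed
  have "(\<integral>\<omega>. F \<omega> \<partial>trajectory_law n S \<phi>) = (\<integral>x. F (case x of (i, s) \<Rightarrow> trajectory \<phi> i s) \<partial>?M)"
    unfolding trajectory_law_def by (intro integral_distr measurable_trajectory_pair F)
  also have "\<dots> = (\<integral>(i, s). F (trajectory \<phi> i s) \<partial>?M)"
    by (simp add: case_prod_unfold)
  also have "\<dots> = (\<integral>i. \<integral>s. F (trajectory \<phi> i s) \<partial>step_space S \<partial>uniform_count_measure {1..n})"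
    using UP.integral_fst'[OF int] by simp
  also have "\<dots> = (\<Sum>i=1..n. \<integral>s. F (trajectory \<phi> i s) \<partial>step_space S) / n"
    using n by (simp add: integral_uniform_count_measure)
  finally show ?thesis .
qed

lemma measure_trajectory_law:
  assumes R: "{\<omega> \<in> space (trajectory_law n S \<phi>). R \<omega>} \<in> sets (trajectory_law n S \<phi>)"
  shows "measure (trajectory_law n S \<phi>) {\<omega> \<in> space (trajectory_law n S \<phi>). R \<omega>}
    = (\<Sum>i=1..n. measure (step_space S) {s \<in> space (step_space S). R (trajectory \<phi> i s)}) / n"
proof -
  let ?P = "trajectory_law n S \<phi>"
  let ?A = "{\<omega> \<in> space ?P. R \<omega>}"
  interpret P: prob_space "step_space S" by (rule prob_space_step_space[OF S])
  interpret L: prob_space "trajectory_law n S \<phi>" by (rule prob_space_trajectory_law)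
  have "measure ?P ?A = (\<integral>\<omega>. indicator ?A \<omega> \<partial>?P)"
    using R by simp
  also have "\<dots> = (\<Sum>i=1..n. \<integral>s. indicator ?A (trajectory \<phi> i s) \<partial>step_space S) / n"
    using R by (intro integral_trajectory_law[where C = 1] borel_measurable_indicator)
      (auto simp: sets_trajectory_law indicator_def)
  also have "(\<Sum>i=1..n. \<integral>s. indicator ?A (trajectory \<phi> i s) \<partial>step_space S)
      = (\<Sum>i=1..n. measure (step_space S) {s \<in> space (step_space S). R (trajectory \<phi> i s)})"
  proof (rule sum.cong[OF refl])
    fix i assume i: "i \<in> {1..n}"
    have eq: "trajectory \<phi> i -` ?A \<inter> space (step_space S)
        = {s \<in> space (step_space S). R (trajectory \<phi> i s)}"
      using trajectory_in[OF i] by (auto simp: space_trajectory_law space_step_space)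
    have "(\<integral>s. indicator ?A (trajectory \<phi> i s) \<partial>step_space S)
        = (\<integral>s. indicator {s \<in> space (step_space S). R (trajectory \<phi> i s)} s \<partial>step_space S)"
      unfolding eq[symmetric] by (intro Bochner_Integration.integral_cong) (auto simp: indicator_def)
    also have "\<dots> = measure (step_space S) {s \<in> space (step_space S). R (trajectory \<phi> i s)}"
      by (simp add: Int_absorb2 subset_iff)
    finally show "(\<integral>s. indicator ?A (trajectory \<phi> i s) \<partial>step_space S)
        = measure (step_space S) {s \<in> space (step_space S). R (trajectory \<phi> i s)}" .
  qed
  finally show ?thesis .
qed

lemma sum_transition:
  assumes "i \<in> {1..n}"
  shows "(\<Sum>j=1..n. transition S \<phi> i j) = 1"
proof -
  have "(\<Sum>j=1..n. card {a \<in> S. \<phi> i a = j}) = (\<Sum>j\<in>{1..n}. \<Sum>a\<in>{a \<in> S. \<phi> i a = j}. 1)"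
    by simp
  also have "\<dots> = (\<Sum>a\<in>S. 1)"
    using S \<phi> assms by (intro sum.group) (auto simp: Pi_iff simp del: atLeastAtMost_iff)
  finally have "(\<Sum>j=1..n. card {a \<in> S. \<phi> i a = j}) = card S" by simp
  then have "(\<Sum>j=1..n. real (card {a \<in> S. \<phi> i a = j})) = card S"
    by (metis of_nat_sum)
  then show ?thesis
    using S by (simp add: transition_def sum_divide_distrib[symmetric])
qed

lemma sets_trajectory_law_prefix:
  "{\<omega> \<in> space (trajectory_law n S \<phi>). \<forall>k\<le>t. \<omega> k = z k} \<in> sets (trajectory_law n S \<phi>)"
proof -
  have [measurable]: "(\<lambda>\<omega>. \<omega> k) \<in> measurable (trajectory_law n S \<phi>) (count_space {1..n})" for k
    unfolding measurable_cong_sets[OF sets_trajectory_law refl]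
    by (intro measurable_component_singleton) simp
  show ?thesis by measurable
qed

lemma markov_chain_trajectory_law: "markov_chain n (trajectory_law n S \<phi>) (transition S \<phi>)"
  unfolding markov_chain_def
proof (intro conjI allI ballI)
  let ?P = "trajectory_law n S \<phi>"
  fix t and z :: "nat \<Rightarrow> nat" assume z: "z \<in> UNIV \<rightarrow> {1..n}"
  have split: "(\<forall>k\<le>Suc t. trajectory \<phi> i s k = z k)
      \<longleftrightarrow> (\<forall>k\<le>t. trajectory \<phi> i s k = z k) \<and> \<phi> (z t) (s t) = z (Suc t)" for i s
  proof -
    have "(\<forall>k\<le>Suc t. trajectory \<phi> i s k = z k)
        \<longleftrightarrow> (\<forall>k\<le>t. trajectory \<phi> i s k = z k) \<and> trajectory \<phi> i s (Suc t) = z (Suc t)"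
      by (metis le_Suc_eq)
    then show ?thesis by auto
  qed
  have "measure ?P {\<omega> \<in> space ?P. \<forall>k\<le>Suc t. \<omega> k = z k}
      = (\<Sum>i=1..n. measure (step_space S)
          {s \<in> space (step_space S). \<forall>k\<le>Suc t. trajectory \<phi> i s k = z k}) / n"
    by (rule measure_trajectory_law[OF sets_trajectory_law_prefix])
  also have "\<dots> = (\<Sum>i=1..n. measure (step_space S)
          {s \<in> space (step_space S). (\<forall>k\<le>t. trajectory \<phi> i s k = z k) \<and> \<phi> (z t) (s t) = z (Suc t)}) / n"
    by (simp add: split)
  also have "\<dots> = (\<Sum>i=1..n. measure (step_space S)
          {s \<in> space (step_space S). \<forall>k\<le>t. trajectory \<phi> i s k = z k} * transition S \<phi> (z t) (z (Suc t))) / n"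
    unfolding transition_def
    by (intro arg_cong2[where f = "(/)"] sum.cong refl
        measure_step_space_next_in[OF S depends_on_prefix_trajectories])
  also have "\<dots> = (\<Sum>i=1..n. measure (step_space S)
          {s \<in> space (step_space S). \<forall>k\<le>t. trajectory \<phi> i s k = z k}) / n * transition S \<phi> (z t) (z (Suc t))"
    by (simp add: sum_distrib_right)
  also have "(\<Sum>i=1..n. measure (step_space S)
          {s \<in> space (step_space S). \<forall>k\<le>t. trajectory \<phi> i s k = z k}) / n
      = measure ?P {\<omega> \<in> space ?P. \<forall>k\<le>t. \<omega> k = z k}"
    by (rule measure_trajectory_law[OF sets_trajectory_law_prefix, symmetric])
  finally show "measure ?P {\<omega> \<in> space ?P. \<forall>k\<le>Suc t. \<omega> k = z k}
      = measure ?P {\<omega> \<in> space ?P. \<forall>k\<le>t. \<omega> k = z k} * transition S \<phi> (z t) (z (Suc t))" .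
qed (use prob_space_trajectory_law sets_trajectory_law sum_transition in \<open>auto simp: transition_def\<close>)

text \<open>A symmetric stochastic matrix is doubly stochastic and therefore preserves the uniform distribution.\<close>

lemma sum_measure_trajectory_uniform:
  assumes sym: "\<forall>i\<in>{1..n}. \<forall>j\<in>{1..n}. transition S \<phi> i j = transition S \<phi> j i"
    and j: "j \<in> {1..n}"
  shows "(\<Sum>i=1..n. measure (step_space S) {s \<in> space (step_space S). trajectory \<phi> i s t = j}) = 1"
  using j
proof (induction t arbitrary: j)
  case 0
  interpret P: prob_space "step_space S" by (rule prob_space_step_space[OF S])
  have "(\<Sum>i=1..n. measure (step_space S) {s \<in> space (step_space S). trajectory \<phi> i s 0 = j})
      = (\<Sum>i=1..n. if i = j then 1 else 0)"
    by (intro sum.cong) (auto simp: P.prob_space)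
  with 0 show ?case by simp
next
  case (Suc t)
  interpret P: prob_space "step_space S" by (rule prob_space_step_space[OF S])
  let ?m = "measure (step_space S)" and ?\<Omega> = "space (step_space S)"
  have step: "?m {s \<in> ?\<Omega>. trajectory \<phi> i s (Suc t) = j}
      = (\<Sum>k=1..n. ?m {s \<in> ?\<Omega>. trajectory \<phi> i s t = k} * transition S \<phi> k j)" if i: "i \<in> {1..n}" for i
  proof -
    define B where "B k = {s \<in> ?\<Omega>. trajectory \<phi> i s t = k \<and> \<phi> k (s t) = j}" for k
    have sets: "B k \<in> P.events" for k
      unfolding B_def
      by (rule depends_on_prefix_sets[OF S depends_on_prefix_conj[OF depends_on_prefix_trajectory]])
    have "{s \<in> ?\<Omega>. trajectory \<phi> i s (Suc t) = j} = (\<Union>k\<in>{1..n}. B k)"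
      using trajectory_in[OF i] by (auto simp: B_def space_step_space simp del: atLeastAtMost_iff)
    also have "?m \<dots> = (\<Sum>k=1..n. ?m (B k))"
      using sets by (intro P.finite_measure_finite_Union) (auto simp: B_def disjoint_family_on_def)
    also have "\<dots> = (\<Sum>k=1..n. ?m {s \<in> ?\<Omega>. trajectory \<phi> i s t = k} * transition S \<phi> k j)"
      unfolding B_def transition_def
      by (intro sum.cong refl measure_step_space_next_in[OF S depends_on_prefix_trajectory])
    finally show ?thesis .
  qed
  have "(\<Sum>i=1..n. ?m {s \<in> ?\<Omega>. trajectory \<phi> i s (Suc t) = j})
      = (\<Sum>i=1..n. \<Sum>k=1..n. ?m {s \<in> ?\<Omega>. trajectory \<phi> i s t = k} * transition S \<phi> k j)"
    using step by (intro sum.cong) auto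
  also have "\<dots> = (\<Sum>k=1..n. (\<Sum>i=1..n. ?m {s \<in> ?\<Omega>. trajectory \<phi> i s t = k}) * transition S \<phi> k j)"
    by (subst sum.swap) (simp add: sum_distrib_right)
  also have "\<dots> = (\<Sum>k=1..n. transition S \<phi> j k)"
    using Suc.IH sym Suc.prems by (intro sum.cong) auto
  finally show ?case
    using sum_transition[OF Suc.prems] by simp
qed

lemma sets_trajectory_law_single:
  "{\<omega> \<in> space (trajectory_law n S \<phi>). \<omega> t = i} \<in> sets (trajectory_law n S \<phi>)"
proof -
  have [measurable]: "(\<lambda>\<omega>. \<omega> k) \<in> measurable (trajectory_law n S \<phi>) (count_space {1..n})" for k
    unfolding measurable_cong_sets[OF sets_trajectory_law refl]
    by (intro measurable_component_singleton) simp
  show ?thesis by measurable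
qed

lemma stationary_reversible_trajectory_law:
  assumes sym: "\<forall>i\<in>{1..n}. \<forall>j\<in>{1..n}. transition S \<phi> i j = transition S \<phi> j i"
  shows "stationary n (trajectory_law n S \<phi>)"
    and "reversible n (trajectory_law n S \<phi>) (transition S \<phi>)"
proof -
  have "measure (trajectory_law n S \<phi>) {\<omega> \<in> space (trajectory_law n S \<phi>). \<omega> t = i} = 1 / n"
    if "i \<in> {1..n}" for i t
    using measure_trajectory_law[OF sets_trajectory_law_single[of t i]]
      sum_measure_trajectory_uniform[OF sym that, of t] by simp
  then show "stationary n (trajectory_law n S \<phi>)"
    and "reversible n (trajectory_law n S \<phi>) (transition S \<phi>)"
    using sym by (simp_all add: stationary_def reversible_def)
qed

end

section \<open>Markov type along the random walk\<close>

lemma measurable_two_coordinates: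
  fixes H :: "nat \<Rightarrow> nat \<Rightarrow> real" and t u :: nat
  shows "(\<lambda>\<omega>. H (\<omega> t) (\<omega> u)) \<in> borel_measurable (\<Pi>\<^sub>M t\<in>UNIV. count_space {1..n})"
proof -
  have c: "(\<lambda>\<omega>. \<omega> k) \<in> measurable (\<Pi>\<^sub>M t\<in>UNIV. count_space {1..n}) (count_space {1..n})"
    for k :: nat
    by (intro measurable_component_singleton) simp
  show ?thesis
  proof (rule measurable_compose_countable'[where f = "\<lambda>i \<omega>. H i (\<omega> u)", OF _ c])
    fix i
    show "(\<lambda>\<omega>. H i (\<omega> u)) \<in> borel_measurable (\<Pi>\<^sub>M t\<in>UNIV. count_space {1..n})"
      by (rule measurable_compose[OF c]) simp
  qed (simp add: countable_finite)
qed

lemma two_coordinates_bounded: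
  fixes H :: "nat \<Rightarrow> nat \<Rightarrow> real"
  shows "\<exists>C. \<forall>i\<in>{1..n}. \<forall>j\<in>{1..n}. \<bar>H i j\<bar> \<le> C"
proof (intro exI ballI)
  fix i j assume ij: "i \<in> {1..n}" "j \<in> {1..n}"
  have "\<bar>H i j\<bar> \<le> (\<Sum>j=1..n. \<bar>H i j\<bar>)"
    using ij by (intro member_le_sum[of j]) auto
  also have "\<dots> \<le> (\<Sum>i=1..n. \<Sum>j=1..n. \<bar>H i j\<bar>)"
    using ij by (intro member_le_sum[of i "{1..n}" "\<lambda>i. \<Sum>j=1..n. \<bar>H i j\<bar>"] sum_nonneg) auto
  finally show "\<bar>H i j\<bar> \<le> (\<Sum>i=1..n. \<Sum>j=1..n. \<bar>H i j\<bar>)" .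
qed

context group
begin

lemma random_walk_closed:
  assumes "S \<subseteq> carrier G" "s \<in> UNIV \<rightarrow> S"
  shows "random_walk G t s \<in> carrier G"
proof (induction t)
  case (Suc t)
  have "s t \<in> carrier G" using assms by blast
  with Suc show ?case by simp
qed simp

lemma finite_random_walk_range:
  assumes "finite S"
  shows "finite (random_walk G t ` (UNIV \<rightarrow> S))"
proof (induction t)
  case 0
  show ?case by (rule finite_subset[of _ "{\<one>}"]) auto
next
  case (Suc t)
  have "random_walk G (Suc t) ` (UNIV \<rightarrow> S)
      \<subseteq> (\<lambda>(w, a). w \<otimes> a) ` (random_walk G t ` (UNIV \<rightarrow> S) \<times> S)"
  proof
    fix y assume "y \<in> random_walk G (Suc t) ` (UNIV \<rightarrow> S)"
    then obtain s where s: "s \<in> UNIV \<rightarrow> S" "y = random_walk G t s \<otimes> s t" by auto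
    then have "(random_walk G t s, s t) \<in> random_walk G t ` (UNIV \<rightarrow> S) \<times> S"
      by blast
    then show "y \<in> (\<lambda>(w, a). w \<otimes> a) ` (random_walk G t ` (UNIV \<rightarrow> S) \<times> S)"
      using s(2) by (intro image_eqI[where x = "(random_walk G t s, s t)"]) auto
  qed
  then show ?case
    using Suc assms by (meson finite_SigmaI finite_imageI finite_subset)
qed

text \<open>Here the Markov type inequality is transferred from finite chains to the random walk on the infinite
  group. The chain on the Folner set \<open>U\<close> ignores steps that leave \<open>U\<close>. Its displacement is bounded
  below only from the starting points in \<open>V\<close>, from which the walk cannot leave \<open>U\<close> before time \<open>t\<close>;
  these have density at least \<open>q\<close>, and \<open>q\<close> tends to 1.\<close>

lemma markov_type_random_walk:
  fixes d :: "'x \<Rightarrow> 'x \<Rightarrow> real" and f :: "'a \<Rightarrow> 'x"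
  assumes "amenable G" and S: "S \<subseteq> carrier G" "finite S" "S \<noteq> {}"
    and sym: "\<And>a. a \<in> S \<Longrightarrow> inv a \<in> S"
    and mt: "markov_type_with p X d K" and f: "f \<in> carrier G \<rightarrow> X"
    and lip: "\<And>x a. x \<in> carrier G \<Longrightarrow> a \<in> S \<Longrightarrow> d (f (x \<otimes> a)) (f x) powr p \<le> 1"
    and lip0: "\<And>x. x \<in> carrier G \<Longrightarrow> d (f x) (f x) powr p \<le> 1"
    and t: "1 \<le> t" and A: "A \<in> sets (step_space S)" and M: "0 \<le> M"
    and low: "\<And>x s. x \<in> carrier G \<Longrightarrow> s \<in> A \<Longrightarrow> M \<le> d (f (x \<otimes> random_walk G t s)) (f x) powr p"
  shows "measure (step_space S) A * M \<le> K powr p * t"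
proof -
  interpret P: prob_space "step_space S" by (rule prob_space_step_space[OF S(2,3)])
  have A_space: "s \<in> UNIV \<rightarrow> S" if "s \<in> A" for s
    using sets.sets_into_space[OF A] that by (auto simp: space_step_space)
  have fraction: "q * (P.prob A * M) \<le> K powr p * t" if q: "0 < q" "q < 1" for q
  proof -
    define T where "T = (\<Union>k\<le>t. random_walk G k ` (UNIV \<rightarrow> S))"
    have T: "finite T" "T \<subseteq> carrier G"
      using finite_random_walk_range[OF S(2)] random_walk_closed[OF S(1)] by (auto simp: T_def)
    obtain V U where VU: "finite V" "V \<noteq> {}" "V \<subseteq> U" "finite U" "U \<subseteq> carrier G"
      "V <#> T \<subseteq> U" "q * card U \<le> card V"
      using amenable_right_Folner[OF \<open>amenable G\<close> T q] by (elim exE conjE) (rule that)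
    define n where "n = card U"
    have n: "1 \<le> n"
      using VU by (simp add: n_def Suc_le_eq card_gt_0_iff) blast
    obtain h where h: "bij_betw h {1..n} U"
      using ex_bij_betw_nat_finite_1[OF VU(4)] by (auto simp: n_def)
    define e where "e = the_inv_into {1..n} h"
    have e: "bij_betw e U {1..n}"
      unfolding e_def by (rule bij_betw_the_inv_into[OF h])
    have he: "h (e x) = x" if "x \<in> U" for x
      using f_the_inv_into_f_bij_betw[OF h] that by (simp add: e_def)
    have eh: "e (h i) = i" if "i \<in> {1..n}" for i
      using the_inv_into_f_f[OF bij_betw_imp_inj_on[OF h] that] by (simp add: e_def)
    have hU: "h i \<in> U" if "i \<in> {1..n}" for i
      using bij_betwE[OF h] that by blast
    have hG: "h i \<in> carrier G" if "i \<in> {1..n}" for i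
      using hU[OF that] VU(5) by blast
    have eU: "e x \<in> {1..n}" if "x \<in> U" for x
      using bij_betwE[OF e] that by blast
    define \<phi> where "\<phi> i a = (if h i \<otimes> a \<in> U then e (h i \<otimes> a) else i)" for i a
    have "\<phi> i a \<in> {1..n}" if "i \<in> {1..n}" for i a
      unfolding \<phi>_def using eU that by (cases "h i \<otimes> a \<in> U") simp_all
    then have \<phi>: "\<phi> \<in> {1..n} \<rightarrow> S \<rightarrow> {1..n}"
      by blast
    have \<phi>_iff: "\<phi> i a = j \<longleftrightarrow> h i \<otimes> a = h j" if "i \<in> {1..n}" "j \<in> {1..n}" "i \<noteq> j" for i j a
      using he eh[OF that(2)] hU[OF that(2)] that(3) by (auto simp: \<phi>_def)
    \<comment> \<open>Inversion of the step matches the moves from \<open>i\<close> to \<open>j\<close> with those from \<open>j\<close> to \<open>i\<close>.\<close>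
    have half: "inv a \<in> {b \<in> S. \<phi> j b = i}"
      if ij: "i \<in> {1..n}" "j \<in> {1..n}" "i \<noteq> j" and a: "a \<in> {a \<in> S. \<phi> i a = j}" for i j a
    proof -
      have "a \<in> carrier G" using a S by auto
      moreover have "h i \<otimes> a = h j" using a \<phi>_iff[OF ij] by simp
      ultimately have "h j \<otimes> inv a = h i"
        using hG[OF ij(1)] by (metis inv_solve_right' hG[OF ij(2)])
      then show ?thesis
        using a sym \<phi>_iff[OF ij(2,1)] ij(3) by auto
    qed
    have trans_sym: "\<forall>i\<in>{1..n}. \<forall>j\<in>{1..n}. transition S \<phi> i j = transition S \<phi> j i"
    proof (intro ballI)
      fix i j assume ij: "i \<in> {1..n}" "j \<in> {1..n}"
      show "transition S \<phi> i j = transition S \<phi> j i"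
      proof (cases "i = j")
        case False
        have "bij_betw (\<lambda>a. inv a) {a \<in> S. \<phi> i a = j} {a \<in> S. \<phi> j a = i}"
        proof (rule bij_betwI[where g = "\<lambda>a. inv a"])
          show "(\<lambda>a. inv a) \<in> {a \<in> S. \<phi> i a = j} \<rightarrow> {a \<in> S. \<phi> j a = i}"
            using half[OF ij False] by blast
          show "(\<lambda>a. inv a) \<in> {a \<in> S. \<phi> j a = i} \<rightarrow> {a \<in> S. \<phi> i a = j}"
            using half[OF ij(2,1) False[symmetric]] by blast
        qed (use S in auto)
        then show ?thesis
          by (simp add: transition_def bij_betw_same_card)
      qed simp
    qed
    let ?P = "trajectory_law n S \<phi>"
    let ?H = "\<lambda>i j. d (f (h i)) (f (h j)) powr p"
    have chain: "markov_chain n ?P (transition S \<phi>)" "stationary n ?P"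
      "reversible n ?P (transition S \<phi>)"
      using markov_chain_trajectory_law[OF n S(2,3) \<phi>]
        stationary_reversible_trajectory_law[OF n S(2,3) \<phi> trans_sym] by simp_all
    have fh: "f \<circ> h \<in> {1..n} \<rightarrow> X"
      using f hG by auto
    have mti: "(\<integral>\<omega>. ?H (\<omega> t) (\<omega> 0) \<partial>?P) \<le> K powr p * t * (\<integral>\<omega>. ?H (\<omega> 1) (\<omega> 0) \<partial>?P)"
      using mt[unfolded markov_type_with_def, rule_format, of n ?P "transition S \<phi>" "f \<circ> h" t]
        chain fh t by simp
    obtain C where C: "\<And>i j. i \<in> {1..n} \<Longrightarrow> j \<in> {1..n} \<Longrightarrow> \<bar>?H i j\<bar> \<le> C"
      using two_coordinates_bounded[of n ?H] by blast
    have law: "(\<integral>\<omega>. ?H (\<omega> u) (\<omega> 0) \<partial>?P)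
        = (\<Sum>i=1..n. \<integral>s. ?H (trajectory \<phi> i s u) i \<partial>step_space S) / n" for u
      using integral_trajectory_law[OF n S(2,3) \<phi> measurable_two_coordinates[of ?H u 0 n], of C] C
      by (simp add: Pi_iff)
    have int: "integrable (step_space S) (\<lambda>s. ?H (trajectory \<phi> i s u) i)" if i: "i \<in> {1..n}" for i u
    proof (rule P.integrable_const_bound[where B = C])
      show "AE s in step_space S. norm (?H (trajectory \<phi> i s u) i) \<le> C"
      proof (rule AE_I2)
        fix s assume "s \<in> space (step_space S)"
        then have "trajectory \<phi> i s u \<in> {1..n}"
          using trajectory_in[OF n S(2,3) \<phi> i] by (simp add: space_step_space)
        from C[OF this i] show "norm (?H (trajectory \<phi> i s u) i) \<le> C" by simp
      qed
      show "(\<lambda>s. ?H (trajectory \<phi> i s u) i) \<in> borel_measurable (step_space S)"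
        using measurable_compose[OF measurable_trajectory[OF n S(2,3) \<phi> i]
            measurable_two_coordinates[of ?H u 0 n]] by simp
    qed
    have upper: "(\<integral>s. ?H (trajectory \<phi> i s 1) i \<partial>step_space S) \<le> 1" if i: "i \<in> {1..n}" for i
    proof (rule P.integral_le_const[OF int[OF i]], rule AE_I2)
      fix s assume "s \<in> space (step_space S)"
      then have "s 0 \<in> S" by (auto simp: space_step_space)
      then show "?H (trajectory \<phi> i s 1) i \<le> 1"
        using lip[OF hG[OF i]] lip0[OF hG[OF i]] he by (simp add: \<phi>_def)
    qed
    have stay: "trajectory \<phi> i s k = e (h i \<otimes> random_walk G k s)"
      if i: "i \<in> {1..n}" "h i \<in> V" and s: "s \<in> UNIV \<rightarrow> S" and "k \<le> t" for i s k
      using \<open>k \<le> t\<close>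
    proof (induction k)
      case 0
      show ?case using eh[OF i(1)] hG[OF i(1)] by simp
    next
      case (Suc k)
      have inU: "h i \<otimes> random_walk G l s \<in> U" if "l \<le> t" for l
      proof -
        have "random_walk G l s \<in> T" using that s by (auto simp: T_def)
        then show ?thesis using VU(6) i(2) by (auto simp: set_mult_def)
      qed
      have sk: "s k \<in> carrier G" using s S(1) by blast
      have "h (trajectory \<phi> i s k) = h i \<otimes> random_walk G k s"
        using Suc he inU[of k] by simp
      moreover have "h i \<otimes> random_walk G k s \<otimes> s k = h i \<otimes> random_walk G (Suc k) s"
        using hG[OF i(1)] random_walk_closed[OF S(1) s] sk by (simp add: m_assoc)
      ultimately show ?case
        using inU[OF Suc.prems] by (simp add: \<phi>_def[of "trajectory \<phi> i s k" "s k"])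
    qed
    have lower: "P.prob A * M \<le> (\<integral>s. ?H (trajectory \<phi> i s t) i \<partial>step_space S)"
      if i: "i \<in> {1..n}" "h i \<in> V" for i
    proof -
      have "P.prob A * M = (\<integral>s. indicator A s * M \<partial>step_space S)"
        using A by simp
      also have "\<dots> \<le> (\<integral>s. ?H (trajectory \<phi> i s t) i \<partial>step_space S)"
      proof (rule integral_mono[OF _ int[OF i(1)]])
        show "integrable (step_space S) (\<lambda>s. indicator A s * M)"
          using A by (intro integrable_mult_left integrable_real_indicator)
            (auto simp: P.emeasure_eq_measure)
        fix s assume s: "s \<in> space (step_space S)"
        show "indicator A s * M \<le> ?H (trajectory \<phi> i s t) i"
        proof (cases "s \<in> A")
          case True
          have "h i \<otimes> random_walk G t s \<in> U"
          proof -
            have "random_walk G t s \<in> T" using s by (auto simp: T_def space_step_space)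
            then show ?thesis using VU(6) i(2) by (auto simp: set_mult_def)
          qed
          then have "h (trajectory \<phi> i s t) = h i \<otimes> random_walk G t s"
            using stay[OF i A_space[OF True], of t] he by simp
          then show ?thesis
            using low[OF hG[OF i(1)] True] True by simp
        qed simp
      qed
      finally show ?thesis .
    qed
    have "q * (P.prob A * M) * n = (q * card U) * (P.prob A * M)"
      by (simp add: n_def)
    also have "\<dots> \<le> card V * (P.prob A * M)"
      using VU(7) M by (intro mult_right_mono) auto
    also have "\<dots> = (\<Sum>i\<in>{i \<in> {1..n}. h i \<in> V}. P.prob A * M)"
    proof -
      have "{i \<in> {1..n}. h i \<in> V} = e ` V"
        using eh he eU VU(3) by (auto intro!: image_eqI[of _ e "h _"] simp del: atLeastAtMost_iff)
      moreover have "inj_on e V"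
        using e VU(3) by (meson bij_betw_def inj_on_subset)
      ultimately show ?thesis by (simp add: card_image)
    qed
    also have "\<dots> \<le> (\<Sum>i\<in>{i \<in> {1..n}. h i \<in> V}. \<integral>s. ?H (trajectory \<phi> i s t) i \<partial>step_space S)"
      using lower by (intro sum_mono) blast
    also have "\<dots> \<le> (\<Sum>i=1..n. \<integral>s. ?H (trajectory \<phi> i s t) i \<partial>step_space S)"
      by (intro sum_mono2) auto
    also have "\<dots> = (\<integral>\<omega>. ?H (\<omega> t) (\<omega> 0) \<partial>?P) * n"
      using n by (simp add: law)
    also have "\<dots> \<le> (K powr p * t * (\<integral>\<omega>. ?H (\<omega> 1) (\<omega> 0) \<partial>?P)) * n"
      using mti by (intro mult_right_mono) auto
    also have "\<dots> = K powr p * t * (\<Sum>i=1..n. \<integral>s. ?H (trajectory \<phi> i s 1) i \<partial>step_space S)"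
      unfolding law using n by simp
    also have "\<dots> \<le> K powr p * t * (\<Sum>i=1..n. 1)"
      using upper by (intro mult_left_mono sum_mono) auto
    finally have "q * (P.prob A * M) * n \<le> K powr p * t * n"
      by simp
    then show ?thesis
      using n by simp
  qed
  show ?thesis
  proof (rule field_le_mult_one_interval)
    fix q :: real assume "0 < q" "q < 1"
    then show "q * (P.prob A * M) \<le> K powr p * t" by (rule fraction)
  qed
qed

lemma word_dist_step:
  assumes "S \<subseteq> carrier G" "inv a \<in> S" "x \<in> carrier G" "a \<in> carrier G"
  shows "word_dist G S (x \<otimes> a) x \<le> 1"
  unfolding word_dist_def
proof (rule Least_le)
  have "inv (x \<otimes> a) \<otimes> x = inv a"
    using assms by (simp add: inv_mult_group m_assoc)
  then show "\<exists>ss. length ss = 1 \<and> set ss \<subseteq> S \<and> inv (x \<otimes> a) \<otimes> x = foldr (\<otimes>) ss \<one>"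
    using assms by (intro exI[of _ "[inv a]"]) simp
qed

lemma word_dist_self:
  assumes "x \<in> carrier G"
  shows "word_dist G S x x = 0"
  unfolding word_dist_def using assms by (intro Least_eq_0) simp

lemma word_dist_translate:
  assumes "x \<in> carrier G" "w \<in> carrier G"
  shows "word_dist G S (x \<otimes> w) x = word_dist G S w \<one>"
proof -
  have "inv (x \<otimes> w) \<otimes> x = inv w \<otimes> \<one>"
    using assms by (simp add: inv_mult_group m_assoc)
  then show ?thesis by (simp add: word_dist_def)
qed

text \<open>By left invariance, the displacement of \<open>f\<close> from any starting point is at least \<open>\<rho> r\<close> on the event
  that the walk from \<open>\<one>\<close> is at distance at least \<open>r\<close>, so \<open>markov_type_random_walk\<close> applies with
  \<open>M = \<rho>(r)\<^sup>p\<close>. The function \<open>d\<close> is arbitrary because the \<open>L\<^sub>2\<close> distance is only a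
  pseudometric on representatives.\<close>

lemma compression_speed_bound:
  fixes d :: "'x \<Rightarrow> 'x \<Rightarrow> real" and f :: "'a \<Rightarrow> 'x"
  assumes "amenable G" and S: "S \<subseteq> carrier G" "finite S"
    and sym: "\<And>a. a \<in> S \<Longrightarrow> inv a \<in> S"
    and p: "1 \<le> p" and K: "0 \<le> K" and mt: "markov_type_with p X d K" and f: "f \<in> carrier G \<rightarrow> X"
    and \<rho>: "\<rho> \<in> {0..} \<rightarrow> {0..}" "mono_on {0..} \<rho>"
    and lower: "\<And>x y. x \<in> carrier G \<Longrightarrow> y \<in> carrier G \<Longrightarrow>
      \<rho> (real (word_dist G S x y)) \<le> d (f x) (f y)"
    and upper: "\<And>x y. x \<in> carrier G \<Longrightarrow> y \<in> carrier G \<Longrightarrow>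
      d (f x) (f y) \<le> real (word_dist G S x y)"
    and r: "0 \<le> r" and \<delta>: "0 < \<delta>" and t: "1 \<le> t"
    and speed: "\<delta> \<le> measure (step_space S)
      {s \<in> space (step_space S). r \<le> real (word_dist G S (random_walk G t s) \<one>)}"
  shows "\<rho> r \<le> K / \<delta> powr (1 / p) * real t powr (1 / p)"
proof -
  let ?A = "{s \<in> space (step_space S). r \<le> real (word_dist G S (random_walk G t s) \<one>)}"
  \<comment> \<open>A set that is not measurable has \<open>measure\<close> 0, so the positive lower bound gives measurability.\<close>
  have A: "?A \<in> sets (step_space S)"
    using speed \<delta> measure_notin_sets[of ?A "step_space S"] by linarith
  have "?A \<noteq> {}"
  proof
    assume "?A = {}"
    from speed[unfolded this] \<delta> show False by simp
  qed
  then have ne: "S \<noteq> {}"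
    by (auto simp: space_step_space)
  have \<rho>_nonneg: "0 \<le> \<rho> x" if "0 \<le> x" for x
    using \<rho>(1) that by auto
  have d_nonneg: "0 \<le> d (f x) (f y)" if "x \<in> carrier G" "y \<in> carrier G" for x y
    using lower[OF that] \<rho>_nonneg[of "real (word_dist G S x y)"] by linarith
  have powr_le_1: "d (f x) (f y) powr p \<le> 1"
    if "x \<in> carrier G" "y \<in> carrier G" "word_dist G S x y \<le> 1" for x y
    using upper[OF that(1,2)] that d_nonneg[OF that(1,2)] p by (intro powr_le1) auto
  have "measure (step_space S) ?A * \<rho> r powr p \<le> K powr p * t"
  proof (rule markov_type_random_walk[OF \<open>amenable G\<close> S ne sym mt f _ _ t A])
    show "d (f (x \<otimes> a)) (f x) powr p \<le> 1" if "x \<in> carrier G" "a \<in> S" for x a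
      using that S(1) sym by (intro powr_le_1 word_dist_step[OF S(1)]) auto
    show "d (f x) (f x) powr p \<le> 1" if "x \<in> carrier G" for x
      using that by (intro powr_le_1) (auto simp: word_dist_self)
    fix x s assume x: "x \<in> carrier G" and s: "s \<in> ?A"
    have w: "random_walk G t s \<in> carrier G"
      using s by (intro random_walk_closed[OF S(1)]) (auto simp: space_step_space)
    have "\<rho> r \<le> \<rho> (real (word_dist G S (random_walk G t s) \<one>))"
      using s r by (intro mono_onD[OF \<rho>(2)]) auto
    also have "\<dots> \<le> d (f (x \<otimes> random_walk G t s)) (f x)"
      using lower[of "x \<otimes> random_walk G t s" x] x w by (simp add: word_dist_translate)
    finally show "\<rho> r powr p \<le> d (f (x \<otimes> random_walk G t s)) (f x) powr p"
      using \<rho>_nonneg[OF r] p by (intro powr_mono2) auto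
  qed (use sym in simp_all)
  moreover have "\<delta> * \<rho> r powr p \<le> measure (step_space S) ?A * \<rho> r powr p"
    using speed by (intro mult_right_mono) auto
  ultimately have "\<rho> r powr p \<le> K powr p * t / \<delta>"
    using \<delta> by (simp add: field_simps)
  then have "(\<rho> r powr p) powr (1 / p) \<le> (K powr p * t / \<delta>) powr (1 / p)"
    using p by (intro powr_mono2) auto
  moreover have "(\<rho> r powr p) powr (1 / p) = \<rho> r"
    using p \<rho>_nonneg[OF r] by (simp add: powr_powr)
  moreover have "(K powr p * t / \<delta>) powr (1 / p) = K / \<delta> powr (1 / p) * real t powr (1 / p)"
    using p K \<delta> by (simp add: powr_mult powr_divide powr_powr)
  ultimately show ?thesis by simp
qed

end

section \<open>Hilbert space has Markov type 2 with constant 1\<close>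

definition markov_op :: "nat \<Rightarrow> (nat \<Rightarrow> nat \<Rightarrow> real) \<Rightarrow> (nat \<Rightarrow> real) \<Rightarrow> nat \<Rightarrow> real" where
  "markov_op n a g = (\<lambda>i. \<Sum>j=1..n. a i j * g j)"

definition weighted_inner :: "nat \<Rightarrow> (nat \<Rightarrow> real) \<Rightarrow> (nat \<Rightarrow> real) \<Rightarrow> (nat \<Rightarrow> real) \<Rightarrow> real" where
  "weighted_inner n \<pi> g h = (\<Sum>i=1..n. \<pi> i * g i * h i)"

context
  fixes n :: nat and \<pi> :: "nat \<Rightarrow> real" and a :: "nat \<Rightarrow> nat \<Rightarrow> real"
  assumes \<pi>: "\<And>i. 0 \<le> \<pi> i"
    and a: "\<And>i j. i \<in> {1..n} \<Longrightarrow> j \<in> {1..n} \<Longrightarrow> 0 \<le> a i j"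
    and rows: "\<And>i. i \<in> {1..n} \<Longrightarrow> (\<Sum>j=1..n. a i j) = 1"
    and rev: "\<And>i j. i \<in> {1..n} \<Longrightarrow> j \<in> {1..n} \<Longrightarrow> \<pi> i * a i j = \<pi> j * a j i"
begin

abbreviation "averaging \<equiv> markov_op n a"

abbreviation "ip \<equiv> weighted_inner n \<pi>"

abbreviation "energy g h \<equiv> ip g h - ip g (averaging h)"

lemma ip_averaging: "ip g (averaging h) = (\<Sum>i=1..n. \<Sum>j=1..n. \<pi> i * a i j * (g i * h j))"
  by (simp add: weighted_inner_def markov_op_def sum_distrib_left mult_ac)

text \<open>Detailed balance is the symmetry of the kernel \<open>\<pi> i * a i j\<close>.\<close>

lemma averaging_selfadjoint: "ip g (averaging h) = ip (averaging g) h"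
proof -
  have "ip g (averaging h) = (\<Sum>j=1..n. \<Sum>i=1..n. \<pi> i * a i j * (g i * h j))"
    unfolding ip_averaging by (rule sum.swap)
  also have "\<dots> = (\<Sum>j=1..n. \<Sum>i=1..n. \<pi> j * a j i * (g i * h j))"
    using rev by (intro sum.cong refl) auto
  also have "\<dots> = ip (averaging g) h"
    by (simp add: weighted_inner_def markov_op_def sum_distrib_left sum_distrib_right mult_ac)
  finally show ?thesis .
qed

text \<open>Twice the right-hand side is the sum of \<open>\<pi> i * a i j * (g i + \<sigma> * g j)\<^sup>2\<close>. The two signs say that
  \<open>1 + A\<close> and \<open>1 - A\<close> are positive, where \<open>A\<close> is the averaging operator: its spectrum lies between \<open>-1\<close> and
  \<open>1\<close>.\<close>

lemma averaging_form:
  fixes \<sigma> :: real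
  assumes "\<sigma>\<^sup>2 = 1"
  shows "0 \<le> ip g g + \<sigma> * ip g (averaging g)"
proof -
  have diag: "ip g g = (\<Sum>i=1..n. \<Sum>j=1..n. \<pi> i * a i j * (g i)\<^sup>2)"
    unfolding weighted_inner_def
  proof (rule sum.cong[OF refl])
    fix i assume "i \<in> {1..n}"
    have "(\<Sum>j=1..n. \<pi> i * a i j * (g i)\<^sup>2) = \<pi> i * (g i)\<^sup>2 * (\<Sum>j=1..n. a i j)"
      by (simp add: sum_distrib_left mult_ac)
    then show "\<pi> i * g i * g i = (\<Sum>j=1..n. \<pi> i * a i j * (g i)\<^sup>2)"
      using rows[OF \<open>i \<in> {1..n}\<close>] by (simp add: power2_eq_square)
  qed
  have diag': "ip g g = (\<Sum>i=1..n. \<Sum>j=1..n. \<pi> i * a i j * (g j)\<^sup>2)"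
  proof -
    have "ip g g = (\<Sum>j=1..n. \<Sum>i=1..n. \<pi> i * a i j * (g i)\<^sup>2)"
      unfolding diag by (rule sum.swap)
    also have "\<dots> = (\<Sum>j=1..n. \<Sum>i=1..n. \<pi> j * a j i * (g i)\<^sup>2)"
      using rev by (intro sum.cong refl) auto
    finally show ?thesis .
  qed
  have "0 \<le> (\<Sum>i=1..n. \<Sum>j=1..n. \<pi> i * a i j * (g i + \<sigma> * g j)\<^sup>2)"
    using \<pi> a by (intro sum_nonneg mult_nonneg_nonneg) auto
  also have "\<dots> = (\<Sum>i=1..n. \<Sum>j=1..n. \<pi> i * a i j * (g i)\<^sup>2 + \<pi> i * a i j * (g j)\<^sup>2
      + 2 * \<sigma> * (\<pi> i * a i j * (g i * g j)))"
    using assms by (intro sum.cong refl) (simp add: power2_sum power_mult_distrib algebra_simps)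
  also have "\<dots> = ip g g + ip g g + 2 * \<sigma> * ip g (averaging g)"
    unfolding ip_averaging sum.distrib diag[symmetric] diag'[symmetric]
    by (simp add: sum_distrib_left)
  finally show ?thesis by simp
qed

lemma ip_commute: "ip g h = ip h g"
  by (simp add: weighted_inner_def mult_ac)

lemma ip_diff: "ip (\<lambda>i. g i - h i) k = ip g k - ip h k"
  by (simp add: weighted_inner_def sum_subtractf algebra_simps)

lemma ip_diff_right: "ip k (\<lambda>i. g i - h i) = ip k g - ip k h"
  by (simp add: weighted_inner_def sum_subtractf algebra_simps)

lemma averaging_diff: "averaging (\<lambda>i. g i - h i) = (\<lambda>i. averaging g i - averaging h i)"
  by (simp add: markov_op_def sum_subtractf algebra_simps)

text \<open>The energies of \<open>g\<close> and \<open>A g\<close> differ by the value of the positive form of \<open>1 + A\<close> at \<open>u = g - A g\<close>.\<close>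

lemma energy_averaging_le: "energy (averaging g) (averaging g) \<le> energy g g"
proof -
  define u where "u = (\<lambda>i. g i - averaging g i)"
  have "0 \<le> ip u u + ip u (averaging u)"
    using averaging_form[of 1 u] by simp
  also have "\<dots> = energy g g - energy (averaging g) (averaging g)"
    unfolding u_def averaging_diff ip_diff ip_diff_right
    using averaging_selfadjoint[of g "averaging g"] averaging_selfadjoint[of g g]
      averaging_selfadjoint[of g "averaging (averaging g)"]
      ip_commute[of "averaging g" g]
    by linarith
  finally show ?thesis by simp
qed

lemma energy_averaging_pow_le: "energy ((averaging ^^ k) g) ((averaging ^^ k) g) \<le> energy g g"
proof (induction k)
  case (Suc k)
  then show ?case
    using energy_averaging_le[of "(averaging ^^ k) g"] by simp
qed simp

text \<open>The left-hand side is the energy form at \<open>(g, A\<^sup>k g)\<close>. It is at most the mean of the energies of \<open>g\<close>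
  and \<open>A\<^sup>k g\<close>, because \<open>g - A\<^sup>k g\<close> has nonnegative energy.\<close>

lemma averaging_pow_decay:
  "ip g ((averaging ^^ k) g) - ip g ((averaging ^^ Suc k) g) \<le> energy g g"
proof -
  define w where "w = (averaging ^^ k) g"
  have "0 \<le> energy (\<lambda>i. g i - w i) (\<lambda>i. g i - w i)"
    using averaging_form[of "-1" "\<lambda>i. g i - w i"] by simp
  also have "\<dots> = energy g g + energy w w - 2 * energy g w"
  proof -
    have e: "ip w (averaging g) = ip g (averaging w)" "ip w g = ip g w"
      using averaging_selfadjoint[of g w] ip_commute by metis+
    show ?thesis
      unfolding averaging_diff ip_diff ip_diff_right e by simp
  qed
  finally have "2 * energy g w \<le> energy g g + energy w w" by simp
  moreover have "energy w w \<le> energy g g"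
    unfolding w_def by (rule energy_averaging_pow_le)
  ultimately show ?thesis
    by (simp add: w_def)
qed

text \<open>For an eigenvalue \<open>x\<close> of \<open>A\<close> this is the inequality \<open>1 - x\<^sup>t \<le> t * (1 - x)\<close>.\<close>

lemma averaging_pow_bound: "ip g g - ip g ((averaging ^^ t) g) \<le> t * energy g g"
proof (induction t)
  case (Suc t)
  have "real (Suc t) * energy g g = t * energy g g + energy g g"
    by (simp add: algebra_simps)
  with Suc averaging_pow_decay[of g t] show ?case by linarith
qed simp

end

lemma markov_chain_space:
  assumes "markov_chain n P a"
  shows "space P = UNIV \<rightarrow> {1..n}"
  using assms sets_eq_imp_space_eq[of P "\<Pi>\<^sub>M t\<in>UNIV. count_space {1..n}"]
  by (simp add: markov_chain_def space_PiM PiE_UNIV_domain)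

lemma markov_chain_event:
  assumes "markov_chain n P a"
  shows "{\<omega> \<in> space P. \<omega> t = i \<and> \<omega> u = j} \<in> sets P"
proof -
  have "sets P = sets (\<Pi>\<^sub>M t\<in>UNIV. count_space {1..n})"
    using assms by (simp add: markov_chain_def)
  note [measurable_cong] = this
  have [measurable]: "(\<lambda>\<omega>. \<omega> k) \<in> measurable P (count_space {1..n})" for k
    by measurable
  show ?thesis by measurable
qed

lemma markov_chain_integrable:
  fixes H :: "nat \<Rightarrow> nat \<Rightarrow> real"
  assumes "markov_chain n P a"
  shows "integrable P (\<lambda>\<omega>. H (\<omega> t) (\<omega> u))"
proof -
  interpret prob_space P using assms by (simp add: markov_chain_def)
  obtain C where C: "\<And>i j. i \<in> {1..n} \<Longrightarrow> j \<in> {1..n} \<Longrightarrow> \<bar>H i j\<bar> \<le> C"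
    using two_coordinates_bounded[of n H] by blast
  show ?thesis
  proof (rule integrable_const_bound[where B = C])
    show "AE \<omega> in P. norm (H (\<omega> t) (\<omega> u)) \<le> C"
      using C by (intro AE_I2) (simp add: markov_chain_space[OF assms] Pi_iff)
    have "sets P = sets (\<Pi>\<^sub>M t\<in>UNIV. count_space {1..n})"
      using assms by (simp add: markov_chain_def)
    then show "(\<lambda>\<omega>. H (\<omega> t) (\<omega> u)) \<in> borel_measurable P"
      using measurable_two_coordinates[of H t u n] by (simp cong: measurable_cong_sets)
  qed
qed

lemma markov_chain_integral:
  fixes H :: "nat \<Rightarrow> nat \<Rightarrow> real"
  assumes "markov_chain n P a"
  shows "(\<integral>\<omega>. H (\<omega> t) (\<omega> u) \<partial>P)
    = (\<Sum>i=1..n. \<Sum>j=1..n. measure P {\<omega> \<in> space P. \<omega> t = i \<and> \<omega> u = j} * H i j)"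
proof -
  interpret prob_space P using assms by (simp add: markov_chain_def)
  let ?E = "\<lambda>i j. {\<omega> \<in> space P. \<omega> t = i \<and> \<omega> u = j}"
  have ev: "?E i j \<in> events" for i j
    by (rule markov_chain_event[OF assms])
  define T where "T i j \<omega> = indicator (?E i j) \<omega> * H i j" for i j \<omega>
  have intT: "integrable P (T i j)" and T: "(\<integral>\<omega>. T i j \<omega> \<partial>P) = prob (?E i j) * H i j" for i j
    unfolding T_def using ev[of i j] by (auto simp: emeasure_eq_measure)
  have "(\<integral>\<omega>. H (\<omega> t) (\<omega> u) \<partial>P) = (\<integral>\<omega>. (\<Sum>i=1..n. \<Sum>j=1..n. T i j \<omega>) \<partial>P)"
  proof (rule Bochner_Integration.integral_cong[OF refl])
    fix \<omega> assume \<omega>: "\<omega> \<in> space P"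
    then have in_n: "\<omega> t \<in> {1..n}" "\<omega> u \<in> {1..n}"
      by (auto simp: markov_chain_space[OF assms])
    have "(\<Sum>i=1..n. \<Sum>j=1..n. T i j \<omega>)
        = (\<Sum>i=1..n. \<Sum>j=1..n. if j = \<omega> u then (if i = \<omega> t then H i j else 0) else 0)"
      using \<omega> by (intro sum.cong refl) (auto simp: T_def)
    also have "\<dots> = H (\<omega> t) (\<omega> u)"
      using in_n by (simp del: atLeastAtMost_iff)
    finally show "H (\<omega> t) (\<omega> u) = (\<Sum>i=1..n. \<Sum>j=1..n. T i j \<omega>)"
      by simp
  qed
  also have "\<dots> = (\<Sum>i=1..n. \<Sum>j=1..n. prob (?E i j) * H i j)"
    using intT by (simp add: Bochner_Integration.integral_sum T)
  finally show ?thesis .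
qed

text \<open>The Markov property is stated for complete initial segments of a path. It is summed over the
  segments that lead from \<open>i\<close> to \<open>k\<close>.\<close>

lemma markov_chain_joint_step:
  assumes mc: "markov_chain n P a" and j: "j \<in> {1..n}"
  shows "measure P {\<omega> \<in> space P. \<omega> 0 = i \<and> \<omega> t = k \<and> \<omega> (Suc t) = j}
    = measure P {\<omega> \<in> space P. \<omega> 0 = i \<and> \<omega> t = k} * a k j"
proof -
  interpret prob_space P using mc by (simp add: markov_chain_def)
  note sp = markov_chain_space[OF mc]
  \<comment> \<open>The value \<open>j\<close> after time \<open>t\<close> is a padding that makes \<open>W\<close> finite and stays in the state space.\<close>
  define W where "W = {z. (\<forall>l. (l \<in> {..t} \<longrightarrow> z l \<in> {1..n}) \<and> (l \<notin> {..t} \<longrightarrow> z l = j))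
    \<and> z 0 = i \<and> z t = k}"
  define C where "C z = {\<omega> \<in> space P. \<forall>l\<le>t. \<omega> l = z l}" for z
  define C' where "C' z = {\<omega> \<in> space P. \<forall>l\<le>Suc t. \<omega> l = (z(Suc t := j)) l}" for z
  have finW: "finite W"
    by (rule finite_subset[OF _ finite_set_of_finite_funs[of "{..t}" "{1..n}" j]])
      (auto simp: W_def)
  have W: "z(Suc t := j) \<in> UNIV \<rightarrow> {1..n}" if "z \<in> W" for z
  proof
    fix l
    show "(z(Suc t := j)) l \<in> {1..n}"
      using that j by (cases "l \<le> t") (auto simp: W_def)
  qed
  have ev: "{\<omega> \<in> space P. \<forall>l\<le>m. \<omega> l = z l} \<in> events" for m z
  proof -
    have "{\<omega> \<in> space P. \<forall>l\<in>{..m}. \<omega> l = z l} \<in> events"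
    proof (rule sets.sets_Collect_countable_Ball)
      show "{\<omega> \<in> space P. \<omega> l = z l} \<in> events" for l
        using markov_chain_event[OF mc, of l "z l" l "z l"] by simp
    qed
    then show ?thesis unfolding Ball_def atMost_iff .
  qed
  have evC: "C z \<in> events" and evC': "C' z \<in> events" for z
    unfolding C_def C'_def by (rule ev)+
  have disj: "disjoint_family_on C W"
    unfolding disjoint_family_on_def
  proof (intro ballI impI equals0I)
    fix y z \<omega> assume yz: "y \<in> W" "z \<in> W" "y \<noteq> z" "\<omega> \<in> C y \<inter> C z"
    have "y l = z l" for l
      using yz by (cases "l \<le> t") (auto simp: W_def C_def)
    with \<open>y \<noteq> z\<close> show False by blast
  qed
  have C'_eq: "C' z = {\<omega> \<in> C z. \<omega> (Suc t) = j}" for z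
    by (auto simp: C_def C'_def le_Suc_eq)
  have disj': "disjoint_family_on C' W"
    using disj unfolding disjoint_family_on_def C'_eq by blast
  have cover: "{\<omega> \<in> space P. \<omega> 0 = i \<and> \<omega> t = k} = (\<Union>z\<in>W. C z)"
  proof (intro equalityI subsetI)
    fix \<omega> assume \<omega>: "\<omega> \<in> {\<omega> \<in> space P. \<omega> 0 = i \<and> \<omega> t = k}"
    define z where "z l = (if l \<le> t then \<omega> l else j)" for l
    have "z \<in> W"
      using \<omega> by (auto simp: W_def z_def sp)
    moreover have "\<omega> \<in> C z"
      using \<omega> by (simp add: C_def z_def)
    ultimately show "\<omega> \<in> (\<Union>z\<in>W. C z)" by blast
  qed (auto simp: C_def W_def)
  have "{\<omega> \<in> space P. \<omega> 0 = i \<and> \<omega> t = k \<and> \<omega> (Suc t) = j}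
      = {\<omega> \<in> {\<omega> \<in> space P. \<omega> 0 = i \<and> \<omega> t = k}. \<omega> (Suc t) = j}"
    by auto
  also have "\<dots> = (\<Union>z\<in>W. C' z)"
    unfolding cover C'_eq by blast
  also have "prob \<dots> = (\<Sum>z\<in>W. prob (C' z))"
    using finW disj' evC' by (intro finite_measure_finite_Union) auto
  also have "\<dots> = (\<Sum>z\<in>W. prob (C z) * a k j)"
  proof (rule sum.cong[OF refl])
    fix z assume z: "z \<in> W"
    let ?y = "z(Suc t := j)"
    have "prob {\<omega> \<in> space P. \<forall>l\<le>Suc t. \<omega> l = ?y l}
        = prob {\<omega> \<in> space P. \<forall>l\<le>t. \<omega> l = ?y l} * a (?y t) (?y (Suc t))"
      using mc W[OF z] unfolding markov_chain_def by blast
    moreover have "{\<omega> \<in> space P. \<forall>l\<le>t. \<omega> l = ?y l} = C z"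
      by (auto simp: C_def)
    moreover have "?y t = k" "?y (Suc t) = j"
      using z by (auto simp: W_def)
    ultimately show "prob (C' z) = prob (C z) * a k j"
      by (simp add: C'_def)
  qed
  also have "\<dots> = prob (\<Union>z\<in>W. C z) * a k j"
    using finite_measure_finite_Union[OF finW _ disj] evC
    by (simp add: sum_distrib_right[symmetric] image_subset_iff)
  finally show ?thesis unfolding cover .
qed

lemma markov_chain_total:
  assumes mc: "markov_chain n P a" and ev: "{\<omega> \<in> space P. Q \<omega>} \<in> sets P"
  shows "measure P {\<omega> \<in> space P. Q \<omega>} = (\<Sum>k=1..n. measure P {\<omega> \<in> space P. Q \<omega> \<and> \<omega> t = k})"
proof -
  interpret prob_space P using mc by (simp add: markov_chain_def)
  let ?B = "\<lambda>k. {\<omega> \<in> space P. Q \<omega> \<and> \<omega> t = k}"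
  have evB: "?B k \<in> events" for k
  proof -
    have "?B k = {\<omega> \<in> space P. Q \<omega>} \<inter> {\<omega> \<in> space P. \<omega> t = k \<and> \<omega> t = k}"
      by auto
    also have "\<dots> \<in> events"
      by (rule sets.Int[OF ev markov_chain_event[OF mc]])
    finally show ?thesis .
  qed
  have "{\<omega> \<in> space P. Q \<omega>} = (\<Union>k\<in>{1..n}. ?B k)"
    by (auto simp: markov_chain_space[OF mc] Pi_iff)
  also have "prob \<dots> = (\<Sum>k=1..n. prob (?B k))"
    using evB by (intro finite_measure_finite_Union) (auto simp: disjoint_family_on_def)
  finally show ?thesis .
qed

lemma markov_chain_joint_Suc:
  assumes mc: "markov_chain n P a" and j: "j \<in> {1..n}"
  shows "measure P {\<omega> \<in> space P. \<omega> 0 = i \<and> \<omega> (Suc t) = j}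
    = (\<Sum>k=1..n. measure P {\<omega> \<in> space P. \<omega> 0 = i \<and> \<omega> t = k} * a k j)"
proof -
  have "measure P {\<omega> \<in> space P. \<omega> 0 = i \<and> \<omega> (Suc t) = j}
      = (\<Sum>k=1..n. measure P {\<omega> \<in> space P. (\<omega> 0 = i \<and> \<omega> (Suc t) = j) \<and> \<omega> t = k})"
    by (rule markov_chain_total[OF mc markov_chain_event[OF mc]])
  also have "\<dots> = (\<Sum>k=1..n. measure P {\<omega> \<in> space P. \<omega> 0 = i \<and> \<omega> t = k \<and> \<omega> (Suc t) = j})"
    by (simp add: conj_ac)
  also have "\<dots> = (\<Sum>k=1..n. measure P {\<omega> \<in> space P. \<omega> 0 = i \<and> \<omega> t = k} * a k j)"
    by (intro sum.cong refl markov_chain_joint_step[OF mc j])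
  finally show ?thesis .
qed

lemma markov_chain_correlation:
  assumes mc: "markov_chain n P a"
  shows "(\<integral>\<omega>. g (\<omega> 0) * h (\<omega> t) \<partial>P)
    = (\<Sum>i=1..n. measure P {\<omega> \<in> space P. \<omega> 0 = i} * g i
        * (markov_op n a ^^ t) h i)"
proof (induction t arbitrary: h)
  case 0
  have diag: "measure P {\<omega> \<in> space P. \<omega> 0 = i \<and> \<omega> 0 = j}
      = (if j = i then measure P {\<omega> \<in> space P. \<omega> 0 = i} else 0)" for i j
  proof (cases "j = i")
    case False
    then have empty: "{\<omega> \<in> space P. \<omega> 0 = i \<and> \<omega> 0 = j} = {}" by auto
    show ?thesis unfolding empty using False by simp
  qed simp
  have "(\<integral>\<omega>. g (\<omega> 0) * h (\<omega> 0) \<partial>P)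
      = (\<Sum>i=1..n. \<Sum>j=1..n. if j = i then measure P {\<omega> \<in> space P. \<omega> 0 = i} * (g i * h j) else 0)"
    unfolding markov_chain_integral[OF mc, of "\<lambda>i j. g i * h j" 0 0] diag
    by (simp only: mult_delta_left)
  also have "\<dots> = (\<Sum>i=1..n. measure P {\<omega> \<in> space P. \<omega> 0 = i} * (g i * h i))"
    by (intro sum.cong refl) (simp only: sum.delta finite_atLeastAtMost if_True)
  finally show ?case
    by (simp add: mult.assoc)
next
  case (Suc t)
  let ?q = "\<lambda>i k. measure P {\<omega> \<in> space P. \<omega> 0 = i \<and> \<omega> t = k}"
  have "(\<integral>\<omega>. g (\<omega> 0) * h (\<omega> (Suc t)) \<partial>P)
      = (\<Sum>i=1..n. \<Sum>j=1..n. (\<Sum>k=1..n. ?q i k * a k j) * (g i * h j))"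
    unfolding markov_chain_integral[OF mc, of "\<lambda>i j. g i * h j" 0 "Suc t"]
    by (intro sum.cong refl) (simp only: markov_chain_joint_Suc[OF mc])
  also have "\<dots> = (\<Sum>i=1..n. \<Sum>j=1..n. \<Sum>k=1..n. ?q i k * (g i * (a k j * h j)))"
    by (simp add: sum_distrib_left sum_distrib_right mult_ac)
  also have "\<dots> = (\<Sum>i=1..n. \<Sum>k=1..n. \<Sum>j=1..n. ?q i k * (g i * (a k j * h j)))"
    by (intro sum.cong refl sum.swap)
  also have "\<dots> = (\<Sum>i=1..n. \<Sum>k=1..n. ?q i k * (g i * markov_op n a h k))"
    by (simp add: markov_op_def sum_distrib_left)
  also have "\<dots> = (\<integral>\<omega>. g (\<omega> 0) * markov_op n a h (\<omega> t) \<partial>P)"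
    using markov_chain_integral[OF mc, of "\<lambda>i k. g i * markov_op n a h k" 0 t] by simp
  finally show ?case
    using Suc.IH[of "markov_op n a h"] by (simp add: funpow_Suc_right del: funpow.simps)
qed

lemma stationary_integral:
  assumes mc: "markov_chain n P a" and st: "stationary n P"
  shows "(\<integral>\<omega>. h (\<omega> t) \<partial>P) = (\<Sum>i=1..n. measure P {\<omega> \<in> space P. \<omega> 0 = i} * h i)"
proof -
  have diag: "measure P {\<omega> \<in> space P. \<omega> t = i \<and> \<omega> t = j}
      = (if j = i then measure P {\<omega> \<in> space P. \<omega> 0 = i} else 0)" if "i \<in> {1..n}" for i j
  proof (cases "j = i")
    case True
    have "measure P {\<omega> \<in> space P. \<omega> t = i} = measure P {\<omega> \<in> space P. \<omega> 0 = i}"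
      using st that unfolding stationary_def by blast
    with True show ?thesis by simp
  next
    case False
    then have empty: "{\<omega> \<in> space P. \<omega> t = i \<and> \<omega> t = j} = {}" by auto
    show ?thesis unfolding empty using False by simp
  qed
  have "(\<integral>\<omega>. h (\<omega> t) \<partial>P)
      = (\<Sum>i=1..n. \<Sum>j=1..n. if j = i then measure P {\<omega> \<in> space P. \<omega> 0 = i} * h i else 0)"
    unfolding markov_chain_integral[OF mc, of "\<lambda>i j. h i" t t]
    by (intro sum.cong refl) (simp only: diag mult_delta_left)
  also have "\<dots> = (\<Sum>i=1..n. measure P {\<omega> \<in> space P. \<omega> 0 = i} * h i)"
    by (intro sum.cong refl) (simp only: sum.delta finite_atLeastAtMost if_True)
  finally show ?thesis .
qed

text \<open>By stationarity the mean square displacement at time \<open>u\<close> is \<open>2 \<langle>f, (1 - A\<^sup>u) f\<rangle>\<close>.\<close>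

lemma real_markov_type_2:
  fixes f :: "nat \<Rightarrow> real"
  assumes mc: "markov_chain n P a" and st: "stationary n P" and rv: "reversible n P a"
  shows "(\<integral>\<omega>. (f (\<omega> t) - f (\<omega> 0))\<^sup>2 \<partial>P) \<le> t * (\<integral>\<omega>. (f (\<omega> 1) - f (\<omega> 0))\<^sup>2 \<partial>P)"
proof -
  define \<pi> where "\<pi> i = measure P {\<omega> \<in> space P. \<omega> 0 = i}" for i
  let ?A = "markov_op n a" and ?ip = "weighted_inner n \<pi>"
  have expand: "(\<integral>\<omega>. (f (\<omega> u) - f (\<omega> 0))\<^sup>2 \<partial>P) = 2 * (?ip f f - ?ip f ((?A ^^ u) f))" for u
  proof -
    have "(\<integral>\<omega>. (f (\<omega> u) - f (\<omega> 0))\<^sup>2 \<partial>P)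
        = (\<integral>\<omega>. (f (\<omega> u))\<^sup>2 + (f (\<omega> 0))\<^sup>2 - 2 * (f (\<omega> 0) * f (\<omega> u)) \<partial>P)"
      by (simp add: power2_diff mult_ac)
    also have "\<dots> = (\<integral>\<omega>. (f (\<omega> u))\<^sup>2 \<partial>P) + (\<integral>\<omega>. (f (\<omega> 0))\<^sup>2 \<partial>P)
        - 2 * (\<integral>\<omega>. f (\<omega> 0) * f (\<omega> u) \<partial>P)"
      using markov_chain_integrable[OF mc, of "\<lambda>i j. (f i)\<^sup>2" u u]
        markov_chain_integrable[OF mc, of "\<lambda>i j. (f i)\<^sup>2" 0 0]
        markov_chain_integrable[OF mc, of "\<lambda>i j. f i * f j" 0 u] by simp
    also have "\<dots> = 2 * (?ip f f - ?ip f ((?A ^^ u) f))"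
      using stationary_integral[OF mc st, of "\<lambda>i. (f i)\<^sup>2"] markov_chain_correlation[OF mc, of f f u]
      by (simp add: weighted_inner_def \<pi>_def power2_eq_square mult_ac)
    finally show ?thesis .
  qed
  have "?ip f f - ?ip f ((?A ^^ t) f) \<le> t * (?ip f f - ?ip f (?A f))"
  proof -
    have 1: "0 \<le> \<pi> i" for i by (simp add: \<pi>_def)
    have 2: "0 \<le> a i j" if "i \<in> {1..n}" "j \<in> {1..n}" for i j
      using mc that unfolding markov_chain_def by blast
    have 3: "(\<Sum>j=1..n. a i j) = 1" if "i \<in> {1..n}" for i
      using mc that unfolding markov_chain_def by blast
    have 4: "\<pi> i * a i j = \<pi> j * a j i" if "i \<in> {1..n}" "j \<in> {1..n}" for i j
      using rv that unfolding reversible_def \<pi>_def by blast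
    show ?thesis
      using averaging_pow_bound[where \<pi> = \<pi> and a = a and n = n and g = f and t = t] 1 2 3 4 by simp
  qed
  then show ?thesis
    unfolding expand[of t] expand[of 1] by (simp add: algebra_simps)
qed

lemma L2_norm_powr_2: "L2_norm g powr 2 = (LINT u:{0..1}|lborel. (g u)\<^sup>2)"
proof -
  have "0 \<le> (LINT u:{0..1}|lborel. (g u)\<^sup>2)"
    unfolding set_lebesgue_integral_def by (intro integral_nonneg_AE) auto
  then show ?thesis
    by (simp add: L2_norm_def powr_numeral)
qed

lemma L2_space_diff_integrable:
  assumes "g \<in> L2_space" "h \<in> L2_space"
  shows "integrable lborel (\<lambda>u. indicator {0..1} u * (g u - h u)\<^sup>2)"
proof (rule Bochner_Integration.integrable_bound)
  have int: "integrable lborel (\<lambda>u. indicator {0..1} u * (k u)\<^sup>2)" if "k \<in> L2_space" for k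
    using that by (simp add: L2_space_def set_integrable_def)
  show "integrable lborel (\<lambda>u. 2 * (indicator {0..1} u * (g u)\<^sup>2) + 2 * (indicator {0..1} u * (h u)\<^sup>2))"
    using int assms by simp
  have [measurable]: "g \<in> borel_measurable lborel" "h \<in> borel_measurable lborel"
    using assms by (auto simp: L2_space_def)
  show "(\<lambda>u. indicator {0..1} u * (g u - h u)\<^sup>2) \<in> borel_measurable lborel"
    by measurable
  show "AE u in lborel. norm (indicator {0..1} u * (g u - h u)\<^sup>2)
      \<le> norm (2 * (indicator {0..1} u * (g u)\<^sup>2) + 2 * (indicator {0..1} u * (h u)\<^sup>2))"
  proof (rule AE_I2)
    fix u :: real
    have "(g u - h u)\<^sup>2 + (g u + h u)\<^sup>2 = 2 * (g u)\<^sup>2 + 2 * (h u)\<^sup>2"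
      by (simp add: power2_eq_square algebra_simps)
    then have "(g u - h u)\<^sup>2 \<le> 2 * (g u)\<^sup>2 + 2 * (h u)\<^sup>2"
      using zero_le_power2[of "g u + h u"] by linarith
    then show "norm (indicator {0..1} u * (g u - h u)\<^sup>2)
        \<le> norm (2 * (indicator {0..1} u * (g u)\<^sup>2) + 2 * (indicator {0..1} u * (h u)\<^sup>2))"
      by (simp add: indicator_def)
  qed
qed

text \<open>The squared \<open>L\<^sub>2\<close> distance is the integral over \<open>u\<close> of the squared distances of the values at \<open>u\<close>, so
  the scalar inequality can be integrated. The state space is finite, hence the order of the
  expectation and this integral is immaterial.\<close>

lemma L2_markov_type_2: "markov_type_with 2 L2_space (\<lambda>g h. L2_norm (\<lambda>u. g u - h u)) 1"
  unfolding markov_type_with_def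
proof (intro allI impI)
  fix n t :: nat and P :: "(nat \<Rightarrow> nat) measure" and a and f :: "nat \<Rightarrow> real \<Rightarrow> real"
  assume "markov_chain n P a \<and> stationary n P \<and> reversible n P a \<and> f \<in> {1..n} \<rightarrow> L2_space \<and> 1 \<le> t"
  then have mc: "markov_chain n P a" and st: "stationary n P" and rv: "reversible n P a"
    and f: "\<And>i. i \<in> {1..n} \<Longrightarrow> f i \<in> L2_space" by auto
  define D where "D u i j = indicator {0..1::real} u * (f i u - f j u)\<^sup>2" for u i j
  have intD: "integrable lborel (\<lambda>u. D u i j)" if "i \<in> {1..n}" "j \<in> {1..n}" for i j
    unfolding D_def by (intro L2_space_diff_integrable f that)
  define q where "q s i j = measure P {\<omega> \<in> space P. \<omega> s = i \<and> \<omega> 0 = j}" for s i j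
  have exchange: "(\<integral>\<omega>. L2_norm (\<lambda>u. f (\<omega> s) u - f (\<omega> 0) u) powr 2 \<partial>P)
      = (\<integral>u. (\<integral>\<omega>. D u (\<omega> s) (\<omega> 0) \<partial>P) \<partial>lborel)" (is ?eq)
    and integrable: "integrable lborel (\<lambda>u. \<integral>\<omega>. D u (\<omega> s) (\<omega> 0) \<partial>P)" (is ?int) for s
  proof -
    have sum: "(\<integral>\<omega>. D u (\<omega> s) (\<omega> 0) \<partial>P) = (\<Sum>i=1..n. \<Sum>j=1..n. q s i j * D u i j)" for u
      using markov_chain_integral[OF mc, of "D u" s 0] by (simp add: q_def)
    show ?int
      unfolding sum using intD
      by (intro Bochner_Integration.integrable_sum integrable_mult_right) auto
    have "(\<integral>\<omega>. L2_norm (\<lambda>u. f (\<omega> s) u - f (\<omega> 0) u) powr 2 \<partial>P)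
        = (\<Sum>i=1..n. \<Sum>j=1..n. q s i j * (\<integral>u. D u i j \<partial>lborel))"
      using markov_chain_integral[OF mc, of "\<lambda>i j. L2_norm (\<lambda>u. f i u - f j u) powr 2" s 0]
      by (simp add: q_def L2_norm_powr_2 set_lebesgue_integral_def D_def)
    also have "\<dots> = (\<integral>u. (\<Sum>i=1..n. \<Sum>j=1..n. q s i j * D u i j) \<partial>lborel)"
    proof -
      have int2: "integrable lborel (\<lambda>u. q s i j * D u i j)" if "i \<in> {1..n}" "j \<in> {1..n}" for i j
        by (intro integrable_mult_right intD that)
      have "(\<integral>u. (\<Sum>i=1..n. \<Sum>j=1..n. q s i j * D u i j) \<partial>lborel)
          = (\<Sum>i=1..n. \<integral>u. (\<Sum>j=1..n. q s i j * D u i j) \<partial>lborel)"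
        by (intro Bochner_Integration.integral_sum Bochner_Integration.integrable_sum int2)
      also have "\<dots> = (\<Sum>i=1..n. \<Sum>j=1..n. \<integral>u. q s i j * D u i j \<partial>lborel)"
        by (intro sum.cong refl Bochner_Integration.integral_sum int2)
      finally show ?thesis by simp
    qed
    finally show ?eq unfolding sum .
  qed
  have pointwise: "(\<integral>\<omega>. D u (\<omega> t) (\<omega> 0) \<partial>P) \<le> t * (\<integral>\<omega>. D u (\<omega> 1) (\<omega> 0) \<partial>P)" for u
    using real_markov_type_2[OF mc st rv, of "\<lambda>i. f i u" t] by (simp add: D_def indicator_def)
  have "(\<integral>u. (\<integral>\<omega>. D u (\<omega> t) (\<omega> 0) \<partial>P) \<partial>lborel)
      \<le> (\<integral>u. t * (\<integral>\<omega>. D u (\<omega> 1) (\<omega> 0) \<partial>P) \<partial>lborel)"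
    using pointwise by (intro integral_mono integrable integrable_mult_right)
  then show "(\<integral>\<omega>. L2_norm (\<lambda>u. f (\<omega> t) u - f (\<omega> 0) u) powr 2 \<partial>P)
      \<le> 1 powr 2 * real t * (\<integral>\<omega>. L2_norm (\<lambda>u. f (\<omega> 1) u - f (\<omega> 0) u) powr 2 \<partial>P)"
    unfolding exchange by simp
qed

section \<open>The bound on compression\<close>

lemma exponent_le_of_powr_bound:
  fixes e C :: real
  assumes "\<And>t :: nat. 1 \<le> t \<Longrightarrow> real t powr e \<le> C"
  shows "e \<le> 0"
proof (rule ccontr)
  assume "\<not> e \<le> 0"
  then have e: "0 < e" by simp
  define M where "M = max C 1"
  obtain t :: nat where t: "M powr (1 / e) < real t"
    using reals_Archimedean2 by blast
  have "1 \<le> M powr (1 / e)"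
    using e by (intro ge_one_powr_ge_zero) (auto simp: M_def)
  with t have t1: "1 \<le> t" by linarith
  have "M = (M powr (1 / e)) powr e"
    using e by (simp add: powr_powr M_def)
  also have "\<dots> < real t powr e"
    using t e by (intro powr_less_mono2) auto
  finally show False
    using assms[OF t1] by (simp add: M_def)
qed

text \<open>With \<open>\<rho> x = b * x powr \<alpha>\<close>, \<open>p = 2\<close> and \<open>K = 1\<close>, the compression bound says that
  \<open>t powr (\<beta> * \<alpha> - 1 / 2)\<close> is bounded in \<open>t\<close>.\<close>

lemma (in group) hilbert_exponent_bound:
  assumes "amenable G" and S: "S \<subseteq> carrier G" "finite S"
    and sym: "\<And>a. a \<in> S \<Longrightarrow> inv a \<in> S"
    and c: "0 < c" and \<delta>: "0 < \<delta>" and \<beta>: "0 < \<beta>"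
    and speed: "\<forall>t\<ge>1. \<delta> \<le> measure (step_space S)
      {s \<in> space (step_space S). c * real t powr \<beta> \<le> real (word_dist G S (random_walk G t s) \<one>)}"
    and \<alpha>: "0 \<le> \<alpha>" and b: "0 < b" and f: "f \<in> carrier G \<rightarrow> L2_space"
    and upper: "\<And>x y. x \<in> carrier G \<Longrightarrow> y \<in> carrier G \<Longrightarrow>
      L2_norm (\<lambda>u. f x u - f y u) \<le> real (word_dist G S x y)"
    and lower: "\<And>x y. x \<in> carrier G \<Longrightarrow> y \<in> carrier G \<Longrightarrow>
      b * real (word_dist G S x y) powr \<alpha> \<le> L2_norm (\<lambda>u. f x u - f y u)"
  shows "\<alpha> \<le> 1 / (2 * \<beta>)"
proof -
  have bound: "real t powr (\<beta> * \<alpha> - 1 / 2) \<le> 1 / \<delta> powr (1 / 2) / (b * c powr \<alpha>)"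
    if t: "1 \<le> t" for t :: nat
  proof -
    have "b * (c * real t powr \<beta>) powr \<alpha> \<le> 1 / \<delta> powr (1 / 2) * real t powr (1 / 2)"
    proof (rule compression_speed_bound[where \<rho> = "\<lambda>x. b * x powr \<alpha>" and \<delta> = \<delta> and S = S
            and f = f and d = "\<lambda>g h. L2_norm (\<lambda>u. g u - h u)",
          OF \<open>amenable G\<close> S sym _ _ L2_markov_type_2 f _ _ lower upper _ \<delta> t])
      show "mono_on {0..} (\<lambda>x. b * x powr \<alpha>)"
        using b \<alpha> by (intro mono_onI mult_left_mono powr_mono2) auto
      show "\<delta> \<le> measure (step_space S)
        {s \<in> space (step_space S). c * real t powr \<beta> \<le> real (word_dist G S (random_walk G t s) \<one>)}"
        using speed t by blast
    qed (use b c in auto)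
    also have "(c * real t powr \<beta>) powr \<alpha> = c powr \<alpha> * real t powr (\<beta> * \<alpha>)"
      using c by (simp add: powr_mult powr_powr)
    finally have "b * c powr \<alpha> * real t powr (\<beta> * \<alpha>) \<le> 1 / \<delta> powr (1 / 2) * real t powr (1 / 2)"
      by (simp add: mult.assoc)
    moreover have "real t powr (\<beta> * \<alpha>) = real t powr (\<beta> * \<alpha> - 1 / 2) * real t powr (1 / 2)"
      using t by (simp add: powr_add[symmetric])
    ultimately have "(b * c powr \<alpha> * real t powr (\<beta> * \<alpha> - 1 / 2)) * real t powr (1 / 2)
        \<le> 1 / \<delta> powr (1 / 2) * real t powr (1 / 2)"
      by (simp only: mult.assoc)
    then have "b * c powr \<alpha> * real t powr (\<beta> * \<alpha> - 1 / 2) \<le> 1 / \<delta> powr (1 / 2)"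
      using t by (simp only: mult_le_cancel_right_pos powr_gt_zero)
    then show ?thesis
      using b c by (subst pos_le_divide_eq) (simp_all add: mult_ac del: divide_divide_eq_left)
  qed
  have "\<beta> * \<alpha> - 1 / 2 \<le> 0"
    by (rule exponent_le_of_powr_bound[OF bound])
  then show ?thesis
    using \<beta> by (simp add: field_simps)
qed

theorem proposition1p1:
  fixes G :: "('a, 'm) monoid_scheme" and S :: "'a set" and c \<delta> \<beta> :: real
  assumes "group G" and "amenable G"
    and "S \<subseteq> carrier G" and "finite S" and "set_inv\<^bsub>G\<^esub> S = S" and "generate G S = carrier G"
    and "0 < c" and "0 < \<delta>" and "0 < \<beta>"
    and "\<forall>t\<ge>1. \<delta> \<le> measure (step_space S)
           {s \<in> space (step_space S).
              c * real t powr \<beta> \<le> real (word_dist G S (random_walk G t s) \<one>\<^bsub>G\<^esub>)}"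
  shows "(\<forall>p (X :: 'b set) dX (f :: 'a \<Rightarrow> 'b) \<rho>.
            1 \<le> p \<and> Metric_space X dX \<and> markov_type p X dX \<and>
            f \<in> carrier G \<rightarrow> X \<and>
            \<rho> \<in> {0..} \<rightarrow> {0..} \<and> mono_on {0..} \<rho> \<and>
            (\<forall>x\<in>carrier G. \<forall>y\<in>carrier G.
               \<rho> (real (word_dist G S x y)) \<le> dX (f x) (f y) \<and>
               dX (f x) (f y) \<le> real (word_dist G S x y)) \<longrightarrow>
            (\<forall>t\<ge>1. \<rho> (c * real t powr \<beta>)
               \<le> markov_type_const p X dX / \<delta> powr (1 / p) * real t powr (1 / p)))
       \<and> hilbert_compression_exponent G S \<le> ennreal (1 / (2 * \<beta>))"
proof (intro conjI allI impI)
  interpret group G by fact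
  have sym: "inv\<^bsub>G\<^esub> a \<in> S" if "a \<in> S" for a
    using that \<open>set_inv\<^bsub>G\<^esub> S = S\<close> unfolding SET_INV_def by blast
  note speed = \<open>\<forall>t\<ge>1. \<delta> \<le> _ t\<close>
  {
    fix p :: real and X :: "'b set" and dX and f :: "'a \<Rightarrow> 'b" and \<rho> :: "real \<Rightarrow> real" and t :: nat
    assume H: "1 \<le> p \<and> Metric_space X dX \<and> markov_type p X dX \<and>
            f \<in> carrier G \<rightarrow> X \<and>
            \<rho> \<in> {0..} \<rightarrow> {0..} \<and> mono_on {0..} \<rho> \<and>
            (\<forall>x\<in>carrier G. \<forall>y\<in>carrier G.
               \<rho> (real (word_dist G S x y)) \<le> dX (f x) (f y) \<and>
               dX (f x) (f y) \<le> real (word_dist G S x y))"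
      and t: "1 \<le> t"
    let ?r = "c * real t powr \<beta>" and ?K = "{K. 0 < K \<and> markov_type_with p X dX K}"
    let ?q = "\<delta> powr (1 / p) / real t powr (1 / p)"
    \<comment> \<open>The infimum over \<open>?K\<close> need not belong to \<open>?K\<close>, so every admissible constant is used and the
      infimum is taken at the end.\<close>
    have each: "\<rho> ?r \<le> K / \<delta> powr (1 / p) * real t powr (1 / p)" if "K \<in> ?K" for K
      using H that t assms(7,8) speed
      by (intro compression_speed_bound[OF \<open>amenable G\<close> assms(3,4) sym, where d = dX and X = X and f = f])
        auto
    have "\<rho> ?r * ?q \<le> Inf ?K"
    proof (rule cInf_greatest)
      show "?K \<noteq> {}"
        using H by (auto simp: markov_type_def)
      show "\<rho> ?r * ?q \<le> K" if "K \<in> ?K" for K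
        using each[OF that] assms(8) t by (simp add: field_simps)
    qed
    then show "\<rho> ?r \<le> markov_type_const p X dX / \<delta> powr (1 / p) * real t powr (1 / p)"
      unfolding markov_type_const_def using assms(8) t by (simp add: field_simps)
  }
  show "hilbert_compression_exponent G S \<le> ennreal (1 / (2 * \<beta>))"
    unfolding hilbert_compression_exponent_def
  proof (rule SUP_least)
    fix \<alpha> assume "\<alpha> \<in> {\<alpha>::real. 0 \<le> \<alpha> \<and>
        (\<exists>f \<in> carrier G \<rightarrow> L2_space. \<exists>c>0.
           (\<forall>x\<in>carrier G. \<forall>y\<in>carrier G.
              L2_norm (\<lambda>u. f x u - f y u) \<le> real (word_dist G S x y)) \<and>
           (\<forall>x\<in>carrier G. \<forall>y\<in>carrier G.
              c * real (word_dist G S x y) powr \<alpha> \<le> L2_norm (\<lambda>u. f x u - f y u)))}"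
    then obtain f b where "0 \<le> \<alpha>" "f \<in> carrier G \<rightarrow> L2_space" "0 < b"
      "\<And>x y. x \<in> carrier G \<Longrightarrow> y \<in> carrier G \<Longrightarrow>
        L2_norm (\<lambda>u. f x u - f y u) \<le> real (word_dist G S x y)"
      "\<And>x y. x \<in> carrier G \<Longrightarrow> y \<in> carrier G \<Longrightarrow>
        b * real (word_dist G S x y) powr \<alpha> \<le> L2_norm (\<lambda>u. f x u - f y u)"
      by auto
    then have "\<alpha> \<le> 1 / (2 * \<beta>)"
      by (intro hilbert_exponent_bound[OF \<open>amenable G\<close> assms(3,4) sym assms(7-10)])
    then show "ennreal \<alpha> \<le> ennreal (1 / (2 * \<beta>))"
      by (rule ennreal_leI)
  qed
qed

end
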